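(* Let $s\in\mathbb{N}$, and let $c_s>0$ be a number such that $c_s/(n+|k|)^s\le\tilde e(n,k,s)$ for all $k\in\mathbb{Z}$ and $n\in\mathbb{N}$. Consider the normalized error criterion for the integration problem $I_k$ over the space $H^s$. For all $k\in\mathbb{Z}$, $k\ne0$, and all $\varepsilon\in(0,1)$ we have $$c_s^{1/s}\left(\frac{\sqrt2\,\pi|k|}{\varepsilon}\right)^{1/s}-|k|\le n^{\rm nor}(\varepsilon,k,s)\le2s+\max\left\{0,\left\lceil\frac3{2\pi}\left(\frac{4\pi|k|}{\varepsilon}\right)^{1/s}\right\rceil-1-|k|\right\},$$ which can be written as $$n^{\rm nor}(\varepsilon,k,s)=\Theta\left(\frac{|k|^{1/s}}{\varepsilon^{1/s}}\right)\qquad\text{as }\varepsilon\to0.$$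
   Context: For $s\in\mathbb{N}=\{1,2,\dots\}$ let $H^s=\{f:[0,1]\to\mathbb{C} : f^{(s-1)}\text{ is absolutely continuous},\ f^{(s)}\in L_2([0,1])\}$ with inner product $$\langle f,g\rangle_s=\sum_{\ell=0}^{s-1}\int_0^1 f^{(\ell)}(x)\,dx\ \int_0^1\overline{g^{(\ell)}(x)}\,dx+\int_0^1 f^{(s)}(x)\,\overline{g^{(s)}(x)}\,dx$$ and norm $\|f\|_{H^s}=\langle f,f\rangle_s^{1/2}$. The periodic subspace is $\widetilde H^s=\{f\in H^s : f^{(\ell)}(0)=f^{(\ell)}(1)\text{ for }\ell=0,\dots,s-1\}$ with the same inner product. For $k\in\mathbb{Z}$, $I_k(f)=\int_0^1 f(x)\,e^{-2\pi i kx}\,dx$. Algorithms using $n$ values have the form $A_n(f)=\sum_{j=1}^n a_j f^{(\ell_j)}(x_j)$ with $a_j\in\mathbb{C}$, $\ell_j\in\{0,\dots,s-1\}$, $x_j\in[0,1]$; for $n=0$ the only algorithm is $A_0=0$. Set $$e(n,k,s)=\inf_{A_n}\ \sup_{f\in H^s,\ \|f\|_{H^s}\le1}|I_k(f)-A_n(f)|,\qquad \tilde e(n,k,s)=\inf_{A_n}\ \sup_{f\in\widetilde H^s,\ \|f\|_{H^s}\le1}|I_k(f)-A_n(f)|.$$ A number $c_s>0$ depending only on $s$ with $c_s/(n+|k|)^s\le\tilde e(n,k,s)$ for all $k\in\mathbb{Z}$, $n\in\mathbb{N}$ is known to exist. The information complexity for the normalized error criterion is $n^{\rm nor}(\varepsilon,k,s)=\min\{n\in\{0,1,2,\dots\}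 : e(n,k,s)\le\varepsilon\,e(0,k,s)\}$. In the $\Theta$-statement the implied constants depend only on $s$, and the two-sided bound holds for all sufficiently small $\varepsilon$ (how small may depend on $s$ and $k$). *)

theory Defs
  imports "HOL-Analysis.Analysis"
begin

text \<open>A function on the unit interval is represented by a function on all of \<^typ>\<open>real\<close>; every notion
  below depends only on its values on \<^term>\<open>{0..1::real}\<close>.\<close>

definition abs_cont_on :: "real set \<Rightarrow> (real \<Rightarrow> 'a::real_normed_vector) \<Rightarrow> bool" where
  "abs_cont_on S f \<longleftrightarrow>
     (\<forall>\<epsilon>>0. \<exists>\<delta>>0. \<forall>d t. d division_of t \<and> t \<subseteq> S \<and> (\<Sum>K\<in>d. measure lborel K) < \<delta> \<longrightarrow>
        (\<Sum>K\<in>d. norm (f (Sup K) - f (Inf K))) < \<epsilon>)"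

text \<open>One-sided derivatives at the end points 0 and 1.  Where the derivative does not exist, the
  value is an unspecified constant.\<close>

definition nderiv :: "nat \<Rightarrow> (real \<Rightarrow> complex) \<Rightarrow> real \<Rightarrow> complex" where
  "nderiv l = ((\<lambda>f x. vector_derivative f (at x within {0..1})) ^^ l)"

text \<open>The last three conditions say that the \<open>s\<close>-th derivative, which exists almost everywhere,
  is in \<open>L\<^sub>2\<close>.  Only \<open>s \<ge> 1\<close> is meaningful.\<close>

definition sobolev :: "nat \<Rightarrow> (real \<Rightarrow> complex) set" where
  "sobolev s = {f.
     (\<forall>l. Suc l < s \<longrightarrow> (\<forall>x\<in>{0..1}. nderiv l f differentiable (at x within {0..1}))) \<and>
     abs_cont_on {0..1} (nderiv (s - 1) f) \<and>
     (AE x in lebesgue_on {0..1}. nderiv (s - 1) f differentiable (at x within {0..1})) \<and>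
     nderiv s f \<in> borel_measurable (lebesgue_on {0..1}) \<and>
     integrable (lebesgue_on {0..1}) (\<lambda>x. (cmod (nderiv s f x))\<^sup>2)}"

definition sobolev_per :: "nat \<Rightarrow> (real \<Rightarrow> complex) set" where
  "sobolev_per s = {f \<in> sobolev s. \<forall>l<s. nderiv l f 0 = nderiv l f 1}"

definition sob_inner :: "nat \<Rightarrow> (real \<Rightarrow> complex) \<Rightarrow> (real \<Rightarrow> complex) \<Rightarrow> complex" where
  "sob_inner s f g =
     (\<Sum>l<s. (LINT x|lebesgue_on {0..1}. nderiv l f x) *
             (LINT x|lebesgue_on {0..1}. cnj (nderiv l g x)))
     + (LINT x|lebesgue_on {0..1}. nderiv s f x * cnj (nderiv s g x))"

text \<open>\<^term>\<open>sob_inner s f f\<close> is a nonnegative real number.\<close>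

definition sob_norm :: "nat \<Rightarrow> (real \<Rightarrow> complex) \<Rightarrow> real" where
  "sob_norm s f = sqrt (Re (sob_inner s f f))"

definition fourier_int :: "int \<Rightarrow> (real \<Rightarrow> complex) \<Rightarrow> complex" where
  "fourier_int k f =
     (LINT x|lebesgue_on {0..1}. f x * exp (- 2 * of_real pi * \<i> * of_int k * of_real x))"

definition algorithms :: "nat \<Rightarrow> nat \<Rightarrow> ((real \<Rightarrow> complex) \<Rightarrow> complex) set" where
  "algorithms n s = {(\<lambda>f. \<Sum>j<n. a j * nderiv (l j) f (x j)) | a l x.
     \<forall>j<n. l j < s \<and> x j \<in> {0..1}}"

text \<open>Errors are extended nonnegative reals, so that suprema and infima need no boundedness
  side conditions.\<close>

definition min_error :: "(real \<Rightarrow> complex) set \<Rightarrow> nat \<Rightarrow> int \<Rightarrow> nat \<Rightarrow> ennreal" where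
  "min_error F n k s =
     (INF A\<in>algorithms n s. SUP f\<in>{f \<in> F. sob_norm s f \<le> 1}. ennreal (cmod (fourier_int k f - A f)))"

definition err :: "nat \<Rightarrow> int \<Rightarrow> nat \<Rightarrow> ennreal" where
  "err n k s = min_error (sobolev s) n k s"

definition err_per :: "nat \<Rightarrow> int \<Rightarrow> nat \<Rightarrow> ennreal" where
  "err_per n k s = min_error (sobolev_per s) n k s"

definition n_nor :: "real \<Rightarrow> int \<Rightarrow> nat \<Rightarrow> nat" where
  "n_nor \<epsilon> k s = (LEAST n. err n k s \<le> ennreal \<epsilon> * err 0 k s)"

end

theory Submission
  imports Defs
begin

text \<open>Write \<open>f\<^sub>l\<close> for the \<open>l\<close>-th derivative of \<open>f\<close> and \<open>\<omega>\<^sub>k = 2 \<pi> \<i> k\<close>.  Everything comes from integration by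
  parts, \<open>I\<^sub>k(f) = I\<^sub>k(f\<^sub>s) / \<omega>\<^sub>k\<^sup>s - \<Sum>l<s. (f\<^sub>l(1) - f\<^sub>l(0)) / \<omega>\<^sub>k\<^sup>l\<^sup>+\<^sup>1\<close> (\<open>fourier_int_parts\<close>).

  The initial error.  Since \<open>f\<^sub>l(1) - f\<^sub>l(0)\<close> is the mean of \<open>f\<^sub>l\<^sub>+\<^sub>1\<close>, which the norm controls, the
  Cauchy--Schwarz inequality gives \<open>e(0,k,s) \<le> \<surd>2 / (2\<pi>|k|)\<close> (\<open>err_zero_le\<close>), and the function
  \<open>x - 1/2\<close>, which has norm 1 for every \<open>s\<close>, gives \<open>e(0,k,s) \<ge> 1 / (2\<pi>|k|)\<close> (\<open>err_zero_ge\<close>).  The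
  lower bound for the complexity is then immediate: the periodic functions form a subset, so the given
  lower bound for the periodic error, compared with \<open>\<epsilon> e(0,k,s)\<close>, can be solved for \<open>n\<close>.

  The upper bound.  It suffices to find algorithms with \<open>2s + m\<close> values and error at most
  \<open>2 (3 / (2\<pi>(m+1+|k|)))\<^sup>s\<close> (\<open>err_upper\<close>).  When \<open>m + 1 \<le> 2|k|\<close>, the \<open>2s\<close> end point values in the
  formula above already suffice, with error \<open>(2\<pi>|k|)\<^sup>-\<^sup>s\<close>.  Otherwise put \<open>N = m + 1\<close> and apply the
  trapezoidal rule with \<open>N\<close> panels to \<open>F(x) = f(x) exp(-2\<pi>\<i>kx)\<close>.  Its error is the limit of the symmetric
  sums of the Fourier coefficients of \<open>F\<close> at the nonzero multiples of \<open>N\<close>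
  (\<open>trapezoid_aliasing\<close>), that is of the \<open>I\<^bsub>k+jN\<^esub>(f)\<close>.  Integration by parts splits each of these into end
  point terms, whose sums over \<open>j\<close> converge and are subtracted by the algorithm, and
  \<open>I\<^bsub>k+jN\<^esub>(f\<^sub>s) / \<omega>\<^bsub>k+jN\<^esub>\<^sup>s\<close>.  Orthonormality of the exponentials bounds the sum of the latter by
  \<open>(\<Sum>j\<noteq>0. |\<omega>\<^bsub>k+jN\<^esub>|\<^sup>-\<^sup>2\<^sup>s)\<^sup>1\<^sup>/\<^sup>2\<close>, and for \<open>2|k| < N\<close> this is at most the required quantity
  (\<open>alias_sum_sq_bound\<close>).

  The aliasing formula holds for absolutely continuous \<open>F\<close> with \<open>F'\<close> in \<open>L\<^sub>2\<close>, which covers \<open>s = 1\<close>.  By parts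
  on every panel, the error is, up to the factor \<open>1/N\<close>, the integral of \<open>F'\<close> against a sawtooth function
  (\<open>trapezoid_error\<close>).  The Fourier series of the sawtooth converges in \<open>L\<^sub>2\<close> because Parseval's identity
  for it is Euler's value of \<open>\<Sum> 1/n\<^sup>2\<close> (\<open>sawtooth_fourier_series\<close>).
\<close>

section \<open>Absolutely continuous functions on the real line\<close>

lemma abs_cont_onD:
  assumes "abs_cont_on S f" "\<epsilon> > 0"
  obtains \<delta> where "\<delta> > 0"
    "\<And>d t. \<lbrakk>d division_of t; t \<subseteq> S; (\<Sum>K\<in>d. measure lborel K) < \<delta>\<rbrakk> \<Longrightarrow> (\<Sum>K\<in>d. norm (f (Sup K) - f (Inf K))) < \<epsilon>"
  using assms unfolding abs_cont_on_def by metis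

lemma abs_cont_onI:
  assumes "\<And>\<epsilon>. \<epsilon> > 0 \<Longrightarrow> \<exists>\<delta>>0. \<forall>d t. d division_of t \<longrightarrow> t \<subseteq> S \<longrightarrow> (\<Sum>K\<in>d. measure lborel K) < \<delta> \<longrightarrow> (\<Sum>K\<in>d. norm (f (Sup K) - f (Inf K))) < \<epsilon>"
  shows "abs_cont_on S f"
  using assms unfolding abs_cont_on_def by meson

lemma abs_cont_on_subset: "abs_cont_on S f \<Longrightarrow> T \<subseteq> S \<Longrightarrow> abs_cont_on T f"
  unfolding abs_cont_on_def by (meson subset_trans)

lemma division_of_real_mem:
  fixes K :: "real set"
  assumes "d division_of t" "K \<in> d"
  shows "Inf K \<in> t" "Sup K \<in> t" "Inf K \<le> Sup K" "K = {Inf K..Sup K}" "measure lborel K = Sup K - Inf K"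
proof -
  obtain a b where K: "K = cbox a b" "K \<noteq> {}" "K \<subseteq> t"
    using assms by (metis division_ofD(2,3,4))
  then show "Inf K \<in> t" "Sup K \<in> t" "Inf K \<le> Sup K" "K = {Inf K..Sup K}" "measure lborel K = Sup K - Inf K"
    by (auto simp: cbox_interval)
qed

lemma abs_cont_on_continuous_on:
  fixes f :: "real \<Rightarrow> 'a::real_normed_vector"
  assumes "abs_cont_on {a..b} f"
  shows "continuous_on {a..b} f"
  unfolding continuous_on_iff
proof (intro ballI allI impI)
  fix x \<epsilon> :: real assume x: "x \<in> {a..b}" and "\<epsilon> > 0"
  then obtain \<delta> where \<delta>: "\<delta> > 0"
    "\<And>d t. \<lbrakk>d division_of t; t \<subseteq> {a..b}; (\<Sum>K\<in>d. measure lborel K) < \<delta>\<rbrakk> \<Longrightarrow> (\<Sum>K\<in>d. norm (f (Sup K) - f (Inf K))) < \<epsilon>"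
    using abs_cont_onD[OF assms] by metis
  have *: "norm (f v - f u) < \<epsilon>" if "u \<in> {a..b}" "v \<in> {a..b}" "u \<le> v" "v - u < \<delta>" for u v
  proof -
    have "{{u..v}} division_of {u..v}"
      using that division_of_self[of u v] by simp
    from \<delta>(2)[OF this] that show ?thesis by auto
  qed
  show "\<exists>\<delta>>0. \<forall>y\<in>{a..b}. dist y x < \<delta> \<longrightarrow> dist (f y) (f x) < \<epsilon>"
  proof (intro exI conjI ballI impI)
    fix y assume "y \<in> {a..b}" "dist y x < \<delta>"
    then show "dist (f y) (f x) < \<epsilon>"
      using *[of x y] *[of y x] x by (cases "x \<le> y") (auto simp: dist_norm norm_minus_commute)
  qed (rule \<delta>(1))
qed

lemma abs_cont_on_lipschitz:
  fixes f :: "real \<Rightarrow> 'a::real_normed_vector"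
  assumes L: "\<And>x y. x \<in> S \<Longrightarrow> y \<in> S \<Longrightarrow> norm (f y - f x) \<le> L * \<bar>y - x\<bar>"
  shows "abs_cont_on S f"
proof (rule abs_cont_onI)
  fix \<epsilon> :: real assume \<epsilon>: "\<epsilon> > 0"
  show "\<exists>\<delta>>0. \<forall>d t. d division_of t \<longrightarrow> t \<subseteq> S \<longrightarrow> (\<Sum>K\<in>d. measure lborel K) < \<delta> \<longrightarrow>
    (\<Sum>K\<in>d. norm (f (Sup K) - f (Inf K))) < \<epsilon>"
  proof (intro exI conjI allI impI)
    show "\<epsilon> / (\<bar>L\<bar> + 1) > 0" using \<epsilon> by simp
    fix d :: "real set set" and t
    assume d: "d division_of t" "t \<subseteq> S" "(\<Sum>K\<in>d. measure lborel K) < \<epsilon> / (\<bar>L\<bar> + 1)"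
    have "(\<Sum>K\<in>d. norm (f (Sup K) - f (Inf K))) \<le> (\<Sum>K\<in>d. (\<bar>L\<bar> + 1) * measure lborel K)"
    proof (rule sum_mono)
      fix K assume K: "K \<in> d"
      note m = division_of_real_mem[OF d(1) K]
      have "norm (f (Sup K) - f (Inf K)) \<le> L * \<bar>Sup K - Inf K\<bar>"
        using L m(1,2) d(2) by blast
      also have "\<dots> \<le> (\<bar>L\<bar> + 1) * \<bar>Sup K - Inf K\<bar>" by (intro mult_right_mono) auto
      finally show "norm (f (Sup K) - f (Inf K)) \<le> (\<bar>L\<bar> + 1) * measure lborel K"
        using m by simp
    qed
    also have "\<dots> = (\<bar>L\<bar> + 1) * (\<Sum>K\<in>d. measure lborel K)"
      by (simp add: sum_distrib_left)
    also have "\<dots> < \<epsilon>" using d(3) by (simp add: field_simps)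
    finally show "(\<Sum>K\<in>d. norm (f (Sup K) - f (Inf K))) < \<epsilon>" .
  qed
qed

lemma abs_cont_on_mult:
  fixes f g :: "real \<Rightarrow> 'a::real_normed_algebra"
  assumes "abs_cont_on S f" "abs_cont_on S g" "bounded (f ` S)" "bounded (g ` S)"
  shows "abs_cont_on S (\<lambda>x. f x * g x)"
proof (rule abs_cont_onI)
  fix \<epsilon> :: real assume \<epsilon>: "\<epsilon> > 0"
  obtain A where A: "A > 0" "\<And>x. x \<in> S \<Longrightarrow> norm (f x) \<le> A"
    using assms(3) by (auto simp: bounded_pos)
  obtain B where B: "B > 0" "\<And>x. x \<in> S \<Longrightarrow> norm (g x) \<le> B"
    using assms(4) by (auto simp: bounded_pos)
  define \<epsilon>' where "\<epsilon>' = \<epsilon> / (A + B)"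
  have "\<epsilon>' > 0" using \<epsilon> A B by (simp add: \<epsilon>'_def)
  obtain \<delta>1 where \<delta>1: "\<delta>1 > 0"
    "\<And>d t. \<lbrakk>d division_of t; t \<subseteq> S; (\<Sum>K\<in>d. measure lborel K) < \<delta>1\<rbrakk> \<Longrightarrow> (\<Sum>K\<in>d. norm (f (Sup K) - f (Inf K))) < \<epsilon>'"
    using abs_cont_onD[OF assms(1) \<open>\<epsilon>' > 0\<close>] by metis
  obtain \<delta>2 where \<delta>2: "\<delta>2 > 0"
    "\<And>d t. \<lbrakk>d division_of t; t \<subseteq> S; (\<Sum>K\<in>d. measure lborel K) < \<delta>2\<rbrakk> \<Longrightarrow> (\<Sum>K\<in>d. norm (g (Sup K) - g (Inf K))) < \<epsilon>'"
    using abs_cont_onD[OF assms(2) \<open>\<epsilon>' > 0\<close>] by metis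
  show "\<exists>\<delta>>0. \<forall>d t. d division_of t \<longrightarrow> t \<subseteq> S \<longrightarrow> (\<Sum>K\<in>d. measure lborel K) < \<delta> \<longrightarrow>
    (\<Sum>K\<in>d. norm (f (Sup K) * g (Sup K) - f (Inf K) * g (Inf K))) < \<epsilon>"
  proof (intro exI conjI allI impI)
    show "min \<delta>1 \<delta>2 > 0" using \<delta>1 \<delta>2 by simp
    fix d :: "real set set" and t
    assume d: "d division_of t" "t \<subseteq> S" "(\<Sum>K\<in>d. measure lborel K) < min \<delta>1 \<delta>2"
    have "(\<Sum>K\<in>d. norm (f (Sup K) * g (Sup K) - f (Inf K) * g (Inf K)))
        \<le> (\<Sum>K\<in>d. A * norm (g (Sup K) - g (Inf K)) + B * norm (f (Sup K) - f (Inf K)))"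
    proof (rule sum_mono)
      fix K assume K: "K \<in> d"
      note m = division_of_real_mem[OF d(1) K]
      have "f (Sup K) * g (Sup K) - f (Inf K) * g (Inf K)
          = f (Sup K) * (g (Sup K) - g (Inf K)) + (f (Sup K) - f (Inf K)) * g (Inf K)"
        by (simp add: algebra_simps)
      also have "norm \<dots> \<le> norm (f (Sup K)) * norm (g (Sup K) - g (Inf K)) + norm (f (Sup K) - f (Inf K)) * norm (g (Inf K))"
        by (intro order_trans[OF norm_triangle_ineq] add_mono norm_mult_ineq)
      also have "\<dots> \<le> A * norm (g (Sup K) - g (Inf K)) + norm (f (Sup K) - f (Inf K)) * B"
        using m(1,2) d(2) A(2) B(2) by (intro add_mono mult_right_mono mult_left_mono) auto
      finally show "norm (f (Sup K) * g (Sup K) - f (Inf K) * g (Inf K))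
        \<le> A * norm (g (Sup K) - g (Inf K)) + B * norm (f (Sup K) - f (Inf K))" by (simp add: mult.commute)
    qed
    also have "\<dots> = A * (\<Sum>K\<in>d. norm (g (Sup K) - g (Inf K))) + B * (\<Sum>K\<in>d. norm (f (Sup K) - f (Inf K)))"
      by (simp add: sum.distrib sum_distrib_left)
    also have "\<dots> < A * \<epsilon>' + B * \<epsilon>'"
      using \<delta>1(2)[OF d(1,2)] \<delta>2(2)[OF d(1,2)] d(3) A B by (intro add_strict_mono mult_strict_left_mono) auto
    also have "\<dots> = (A + B) * \<epsilon>'" by (simp add: distrib_right)
    also have "\<dots> = \<epsilon>" using A(1) B(1) by (simp add: \<epsilon>'_def)
    finally show "(\<Sum>K\<in>d. norm (f (Sup K) * g (Sup K) - f (Inf K) * g (Inf K))) < \<epsilon>" .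
  qed
qed

text \<open>The divisions that test the Henstock--Kurzweil integral split according to whether the tag lies in the
  exceptional null set \<open>N\<close>.  Tags outside \<open>N\<close> are handled by differentiability.  The intervals with tags
  in \<open>N\<close> lie in an open set of measure below \<open>\<delta>\<close>, so absolute continuity makes the total increment of
  \<open>F\<close> over them small.\<close>

theorem abs_cont_fundamental_theorem_of_calculus:
  fixes F :: "real \<Rightarrow> 'a::banach"
  assumes ab: "a \<le> b" and ac: "abs_cont_on {a..b} F" and N: "negligible N"
    and D: "\<And>x. x \<in> {a..b} - N \<Longrightarrow> (F has_vector_derivative D x) (at x within {a..b})"
  shows "(D has_integral (F b - F a)) {a..b}"
proof -
  define E where "E x = (if x \<in> N then 0 else D x)" for x
  have "(E has_integral (F b - F a)) {a..b}"
    unfolding has_integral_real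
  proof (intro allI impI)
    fix e :: real assume "e > 0"
    define e' where "e' = e / (2 * (b - a + 1))"
    have e': "e' > 0" "e' * (b - a) < e / 2"
      using ab \<open>e > 0\<close> by (auto simp: e'_def field_simps)
    obtain \<delta> where \<delta>: "\<delta> > 0"
      "\<And>d t. \<lbrakk>d division_of t; t \<subseteq> {a..b}; (\<Sum>K\<in>d. measure lborel K) < \<delta>\<rbrakk> \<Longrightarrow> (\<Sum>K\<in>d. norm (F (Sup K) - F (Inf K))) < e / 2"
      using abs_cont_onD[OF ac half_gt_zero[OF \<open>e > 0\<close>]] by metis
    obtain U where U: "open U" "N \<subseteq> U" "(U - N) \<in> lmeasurable" "emeasure lebesgue (U - N) < ennreal \<delta>"
      using sets_lebesgue_outer_open[of N \<delta>] N \<delta>(1) by (auto simp: negligible_imp_sets)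
    have Nn: "N \<in> null_sets lebesgue" using N by (simp add: negligible_iff_null_sets)
    have UN: "U = (U - N) \<union> N" using U(2) by blast
    have Um: "U \<in> lmeasurable"
      using UN fmeasurable.Un[OF U(3), of N] negligible_imp_measurable[OF N] by simp
    have "emeasure lebesgue U = emeasure lebesgue (U - N)"
      using Nn Um by (metis emeasure_Diff_null_set fmeasurableD)
    with U(4) have Ue: "emeasure lebesgue U < ennreal \<delta>" by simp
    then have Uless: "measure lebesgue U < \<delta>"
      using emeasure_eq_measure2[OF Um] \<delta>(1) by (simp add: ennreal_less_iff)
    have "\<exists>r>0. (x \<in> N \<longrightarrow> ball x r \<subseteq> U) \<and>
        (x \<in> {a..b} - N \<longrightarrow> (\<forall>y\<in>{a..b}. norm (y - x) < r \<longrightarrow> norm (F y - F x - (y - x) *\<^sub>R D x) \<le> e' * norm (y - x)))" for x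
    proof (cases "x \<in> N")
      case True
      then show ?thesis using U(1,2) by (auto simp: open_contains_ball)
    next
      case False
      show ?thesis
      proof (cases "x \<in> {a..b}")
        case True
        then have "(F has_vector_derivative D x) (at x within {a..b})" using D False by blast
        then show ?thesis
          unfolding has_vector_derivative_def has_derivative_within_alt using \<open>e' > 0\<close> False by blast
      next
        case nb: False then show ?thesis using False by (intro exI[of _ 1]) auto
      qed
    qed
    then obtain r where r: "\<And>x. r x > 0" "\<And>x. x \<in> N \<Longrightarrow> ball x (r x) \<subseteq> U"
      "\<And>x y. \<lbrakk>x \<in> {a..b} - N; y \<in> {a..b}; norm (y - x) < r x\<rbrakk> \<Longrightarrow> norm (F y - F x - (y - x) *\<^sub>R D x) \<le> e' * norm (y - x)"
      by metis
    show "\<exists>\<gamma>. gauge \<gamma> \<and> (\<forall>p. p tagged_division_of {a..b} \<and> \<gamma> fine p \<longrightarrow>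
        norm ((\<Sum>(x, k)\<in>p. measure lborel k *\<^sub>R E x) - (F b - F a)) < e)"
    proof (intro exI conjI allI impI)
      show "gauge (\<lambda>x. ball x (r x))" using r(1) gauge_ball_dependent by blast
      fix p assume "p tagged_division_of {a..b} \<and> (\<lambda>x. ball x (r x)) fine p"
      then have p: "p tagged_division_of {a..b}" and fine: "(\<lambda>x. ball x (r x)) fine p" by auto
      note pD = tagged_division_ofD[OF p]
      have fin: "finite p" by (rule pD(1))
      have int: "x \<in> K" "K \<subseteq> {a..b}" "K = {Inf K..Sup K}" "Inf K \<in> K" "Sup K \<in> K" "Inf K \<le> Sup K"
          "measure lborel K = Sup K - Inf K" "K \<subseteq> ball x (r x)"
        if xKp: "(x, K) \<in> p" for x K
      proof -
        obtain u v where K: "K = cbox u v" using pD(4)[OF xKp] by blast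
        have xK: "x \<in> K" using pD(2)[OF xKp] .
        then have "u \<le> v" by (auto simp: K)
        then show "x \<in> K" "K = {Inf K..Sup K}" "Inf K \<in> K" "Sup K \<in> K" "Inf K \<le> Sup K" "measure lborel K = Sup K - Inf K"
          using xK by (auto simp: K)
        show "K \<subseteq> {a..b}" using pD(3)[OF xKp] .
        show "K \<subseteq> ball x (r x)" using fine xKp by (auto simp: fine_def)
      qed
      \<comment> \<open>\<open>p1\<close> collects the intervals with exceptional tags\<close>
      define p1 where "p1 = {(x, K) \<in> p. x \<in> N}"
      define p2 where "p2 = {(x, K) \<in> p. x \<notin> N}"
      have p12: "p = p1 \<union> p2" "p1 \<inter> p2 = {}" "finite p1" "finite p2" "p1 \<subseteq> p" "p2 \<subseteq> p"
        using fin by (auto simp: p1_def p2_def intro: finite_subset)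
      have part: "p1 tagged_partial_division_of {a..b}"
        by (rule tagged_partial_division_subset[OF _ p12(5)]) (use p in \<open>simp add: tagged_division_of_def\<close>)
      have "norm ((\<Sum>(x, K)\<in>p. measure lborel K *\<^sub>R E x) - (F b - F a))
          = norm (\<Sum>(x, K)\<in>p. measure lborel K *\<^sub>R E x - (F (Sup K) - F (Inf K)))"
        using additive_tagged_division_1[OF ab p, of F] by (simp add: sum_subtractf split_def)
      also have "\<dots> \<le> (\<Sum>(x, K)\<in>p. norm (measure lborel K *\<^sub>R E x - (F (Sup K) - F (Inf K))))"
        by (simp add: split_def norm_sum)
      also have "\<dots> = (\<Sum>(x, K)\<in>p1. norm (measure lborel K *\<^sub>R E x - (F (Sup K) - F (Inf K))))
          + (\<Sum>(x, K)\<in>p2. norm (measure lborel K *\<^sub>R E x - (F (Sup K) - F (Inf K))))"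
        using p12 by (simp add: sum.union_disjoint)
      also have "(\<Sum>(x, K)\<in>p1. norm (measure lborel K *\<^sub>R E x - (F (Sup K) - F (Inf K)))) < e / 2"
      proof -
        have "(\<Sum>(x, K)\<in>p1. norm (measure lborel K *\<^sub>R E x - (F (Sup K) - F (Inf K))))
            = (\<Sum>(x, K)\<in>p1. norm (F (Sup K) - F (Inf K)))"
          by (rule sum.cong) (auto simp: p1_def E_def norm_minus_commute)
        \<comment> \<open>an interval may carry two tags, but only if it is degenerate and contributes 0\<close>
        also have "\<dots> = (\<Sum>K\<in>snd ` p1. norm (F (Sup K) - F (Inf K)))"
        proof -
          have ne: "K \<noteq> {}" if "(x, K) \<in> p1" for x K using int(1) that p12(5) by blast
          have "(\<Sum>(x, K)\<in>p1. if K = {} then 0 else norm (F (Sup K) - F (Inf K)))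
             = (\<Sum>K\<in>snd ` p1. if K = {} then 0 else norm (F (Sup K) - F (Inf K)))"
            by (rule sum.over_tagged_division_lemma[OF tagged_partial_division_of_Union_self[OF part]])
               (auto simp: cbox_interval box_real)
          moreover have "(\<Sum>(x, K)\<in>p1. if K = {} then 0 else norm (F (Sup K) - F (Inf K)))
              = (\<Sum>(x, K)\<in>p1. norm (F (Sup K) - F (Inf K)))"
            by (rule sum.cong) (auto dest: ne)
          moreover have "(\<Sum>K\<in>snd ` p1. if K = {} then 0 else norm (F (Sup K) - F (Inf K)))
              = (\<Sum>K\<in>snd ` p1. norm (F (Sup K) - F (Inf K)))"
            by (rule sum.cong) (auto dest: ne)
          ultimately show ?thesis by simp
        qed
        also have "\<dots> < e / 2"
        proof (rule \<delta>(2))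
          show d: "snd ` p1 division_of \<Union>(snd ` p1)"
            using part by (rule partial_division_of_tagged_division)
          show "\<Union>(snd ` p1) \<subseteq> {a..b}" using int(2) p12(5) by fastforce
          have "(\<Sum>K\<in>snd ` p1. measure lborel K) = (\<Sum>K\<in>snd ` p1. measure lebesgue K)"
            by (rule sum.cong) (use d in \<open>auto simp: division_of_def\<close>)
          also have "\<dots> = measure lebesgue (\<Union>(snd ` p1))" using content_division[OF d] .
          also have "\<dots> \<le> measure lebesgue U"
          proof (rule measure_mono_fmeasurable)
            show "\<Union>(snd ` p1) \<subseteq> U" using int(8) r(2) unfolding p1_def by fastforce
            show "\<Union>(snd ` p1) \<in> sets lebesgue" 
              using lmeasurable_division[OF d] by auto
          qed (rule Um)
          finally show "(\<Sum>K\<in>snd ` p1. measure lborel K) < \<delta>" using Uless by simp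
        qed
        finally show ?thesis .
      qed
      also have "(\<Sum>(x, K)\<in>p2. norm (measure lborel K *\<^sub>R E x - (F (Sup K) - F (Inf K)))) \<le> (\<Sum>(x, K)\<in>p2. e' * (Sup K - Inf K))"
      proof (rule sum_mono, clarify)
        fix x K assume "(x, K) \<in> p2"
        then have xK: "(x, K) \<in> p" "x \<notin> N" by (auto simp: p2_def)
        note i = int[OF xK(1)]
        have x: "x \<in> {a..b} - N" using i xK by auto
        have S: "norm (F (Sup K) - F x - (Sup K - x) *\<^sub>R D x) \<le> e' * norm (Sup K - x)"
          by (rule r(3)[OF x]) (use i in \<open>auto simp: dist_real_def subset_iff\<close>)
        have I: "norm (F (Inf K) - F x - (Inf K - x) *\<^sub>R D x) \<le> e' * norm (Inf K - x)"
          by (rule r(3)[OF x]) (use i in \<open>auto simp: dist_real_def subset_iff\<close>)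
        have "measure lborel K *\<^sub>R E x - (F (Sup K) - F (Inf K)) =
            (F (Inf K) - F x - (Inf K - x) *\<^sub>R D x) - (F (Sup K) - F x - (Sup K - x) *\<^sub>R D x)"
          using xK(2) unfolding i(7) by (simp add: E_def algebra_simps)
        also have "norm \<dots> \<le> e' * norm (Inf K - x) + e' * norm (Sup K - x)"
          by (rule order_trans[OF norm_triangle_ineq4 add_mono[OF I S]])
        also have "\<dots> = e' * (Sup K - Inf K)"
        proof -
          have "Inf K \<le> x" "x \<le> Sup K" using i(1,3) by (metis atLeastAtMost_iff)+
          then show ?thesis by (simp add: algebra_simps)
        qed
        finally show "norm (measure lborel K *\<^sub>R E x - (F (Sup K) - F (Inf K))) \<le> e' * (Sup K - Inf K)" .
      qed
      also have "(\<Sum>(x, K)\<in>p2. e' * (Sup K - Inf K)) \<le> (\<Sum>(x, K)\<in>p. e' * (Sup K - Inf K))"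
        by (rule sum_mono2) (use fin p12(6) int(6) e'(1) in \<open>auto intro!: mult_nonneg_nonneg\<close>)
      also have "\<dots> = e' * (b - a)"
        using additive_tagged_division_1[OF ab p, of "\<lambda>x. x"] by (simp add: split_def sum_distrib_left[symmetric])
      finally show "norm ((\<Sum>(x, K)\<in>p. measure lborel K *\<^sub>R E x) - (F b - F a)) < e"
        using e'(2) by simp
    qed
  qed
  then show ?thesis
    by (rule has_integral_spike[OF N, rotated]) (auto simp: E_def)
qed

section \<open>Square integrable functions and derivatives on the unit interval\<close>

lemma Cauchy_Schwarz_integral:
  fixes u v :: "'a \<Rightarrow> complex"
  assumes [measurable]: "u \<in> borel_measurable M" "v \<in> borel_measurable M"
    and u: "integrable M (\<lambda>x. (cmod (u x))\<^sup>2)" and v: "integrable M (\<lambda>x. (cmod (v x))\<^sup>2)"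
  shows "integrable M (\<lambda>x. u x * v x)"
    and "cmod (LINT x|M. u x * v x) \<le> sqrt (LINT x|M. (cmod (u x))\<^sup>2) * sqrt (LINT x|M. (cmod (v x))\<^sup>2)"
proof -
  let ?A = "LINT x|M. (cmod (u x))\<^sup>2" and ?B = "LINT x|M. (cmod (v x))\<^sup>2"
  show int: "integrable M (\<lambda>x. u x * v x)"
  proof (rule Bochner_Integration.integrable_bound[OF Bochner_Integration.integrable_add[OF u v]])
    have "cmod (u x) * cmod (v x) \<le> (cmod (u x))\<^sup>2 + (cmod (v x))\<^sup>2" for x
      using sum_squares_bound[of "cmod (u x)" "cmod (v x)"] mult_nonneg_nonneg[OF norm_ge_zero norm_ge_zero, of "u x" "v x"]
      by linarith
    then show "AE x in M. norm (u x * v x) \<le> norm ((cmod (u x))\<^sup>2 + (cmod (v x))\<^sup>2)"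
      by (simp add: norm_mult)
  qed simp
  have "(\<integral>\<^sup>+x. ennreal (cmod (u x)) * ennreal (cmod (v x)) \<partial>M)\<^sup>2
      \<le> (\<integral>\<^sup>+x. (ennreal (cmod (u x)))\<^sup>2 \<partial>M) * (\<integral>\<^sup>+x. (ennreal (cmod (v x)))\<^sup>2 \<partial>M)"
    by (rule Cauchy_Schwarz_nn_integral) auto
  also have "(\<integral>\<^sup>+x. (ennreal (cmod (u x)))\<^sup>2 \<partial>M) = ennreal ?A"
    using nn_integral_eq_integral[OF u] by (simp add: ennreal_power)
  also have "(\<integral>\<^sup>+x. (ennreal (cmod (v x)))\<^sup>2 \<partial>M) = ennreal ?B"
    using nn_integral_eq_integral[OF v] by (simp add: ennreal_power)
  also have "(\<integral>\<^sup>+x. ennreal (cmod (u x)) * ennreal (cmod (v x)) \<partial>M) = ennreal (LINT x|M. cmod (u x * v x))"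
    using nn_integral_eq_integral[OF integrable_norm[OF int]] by (simp add: norm_mult ennreal_mult)
  finally have "(LINT x|M. cmod (u x * v x))\<^sup>2 \<le> ?A * ?B"
    by (simp add: ennreal_power ennreal_mult[symmetric])
  then have "(LINT x|M. cmod (u x * v x)) \<le> sqrt (?A * ?B)"
    by (rule real_le_rsqrt)
  then show "cmod (LINT x|M. u x * v x) \<le> sqrt ?A * sqrt ?B"
    unfolding real_sqrt_mult by (rule order_trans[OF integral_norm_bound])
qed

definition sq_integrable :: "(real \<Rightarrow> complex) \<Rightarrow> bool" where
  "sq_integrable u \<longleftrightarrow> u \<in> borel_measurable (lebesgue_on {0..1}) \<and>
     integrable (lebesgue_on {0..1}) (\<lambda>x. (cmod (u x))\<^sup>2)"

definition L2norm :: "(real \<Rightarrow> complex) \<Rightarrow> real" where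
  "L2norm u = sqrt (LINT x|lebesgue_on {0..1}. (cmod (u x))\<^sup>2)"

lemma L2norm_nonneg [simp]: "L2norm u \<ge> 0"
  by (simp add: L2norm_def)

lemma measure_lebesgue_on_unit [simp]: "measure (lebesgue_on {0..1::real}) {0..1} = 1"
  by (simp add: measure_restrict_space)

lemma sq_integrable_mult:
  assumes "sq_integrable u" "sq_integrable v"
  shows "integrable (lebesgue_on {0..1}) (\<lambda>x. u x * v x)"
    and "cmod (LINT x|lebesgue_on {0..1}. u x * v x) \<le> L2norm u * L2norm v"
  using Cauchy_Schwarz_integral[of u "lebesgue_on {0..1}" v] assms by (auto simp: sq_integrable_def L2norm_def)

lemma sq_integrable_bound:
  assumes "sq_integrable u" "v \<in> borel_measurable (lebesgue_on {0..1})" "\<And>x. x \<in> {0..1} \<Longrightarrow> cmod (v x) \<le> C * cmod (u x)"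
  shows "sq_integrable v"
  unfolding sq_integrable_def
proof
  have "integrable (lebesgue_on {0..1}) (\<lambda>x. C\<^sup>2 * (cmod (u x))\<^sup>2)"
    using assms(1) by (auto simp: sq_integrable_def)
  then show "integrable (lebesgue_on {0..1}) (\<lambda>x. (cmod (v x))\<^sup>2)"
  proof (rule Bochner_Integration.integrable_bound)
    show "AE x in lebesgue_on {0..1}. norm ((cmod (v x))\<^sup>2) \<le> norm (C\<^sup>2 * (cmod (u x))\<^sup>2)"
      using assms(3) by (intro AE_I2) (auto simp: power_mult_distrib[symmetric] power_mono)
  qed (use assms(2) in measurable)
qed (rule assms(2))

lemma sq_integrable_continuous:
  assumes "continuous_on {0..1} u" shows "sq_integrable u"
  unfolding sq_integrable_def
proof
  show "u \<in> borel_measurable (lebesgue_on {0..1})"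
    by (rule continuous_imp_measurable_on_sets_lebesgue[OF assms]) simp
  show "integrable (lebesgue_on {0..1}) (\<lambda>x. (cmod (u x))\<^sup>2)"
    by (intro continuous_imp_integrable_real continuous_intros assms)
qed

lemma sq_integrable_add:
  assumes "sq_integrable u" "sq_integrable v" shows "sq_integrable (\<lambda>x. u x + v x)"
  unfolding sq_integrable_def
proof
  have [measurable]: "u \<in> borel_measurable (lebesgue_on {0..1})" "v \<in> borel_measurable (lebesgue_on {0..1})"
    using assms by (auto simp: sq_integrable_def)
  show "(\<lambda>x. u x + v x) \<in> borel_measurable (lebesgue_on {0..1})" by measurable
  have "integrable (lebesgue_on {0..1}) (\<lambda>x. 2 * ((cmod (u x))\<^sup>2 + (cmod (v x))\<^sup>2))"
    using assms by (auto simp: sq_integrable_def)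
  then show "integrable (lebesgue_on {0..1}) (\<lambda>x. (cmod (u x + v x))\<^sup>2)"
  proof (rule Bochner_Integration.integrable_bound)
    have "(cmod (u x + v x))\<^sup>2 \<le> 2 * ((cmod (u x))\<^sup>2 + (cmod (v x))\<^sup>2)" for x
    proof -
      have "(cmod (u x + v x))\<^sup>2 \<le> (cmod (u x) + cmod (v x))\<^sup>2"
        by (intro power_mono norm_triangle_ineq) simp
      also have "\<dots> \<le> 2 * ((cmod (u x))\<^sup>2 + (cmod (v x))\<^sup>2)"
        using sum_squares_bound[of "cmod (u x)" "cmod (v x)"] by (simp add: power2_sum)
      finally show ?thesis .
    qed
    then show "AE x in lebesgue_on {0..1}. norm ((cmod (u x + v x))\<^sup>2) \<le> norm (2 * ((cmod (u x))\<^sup>2 + (cmod (v x))\<^sup>2))"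
      by simp
  qed measurable
qed

lemma sq_integrable_mult_bounded:
  assumes "sq_integrable u" "v \<in> borel_measurable (lebesgue_on {0..1})" "\<And>x. x \<in> {0..1} \<Longrightarrow> cmod (v x) \<le> C"
  shows "sq_integrable (\<lambda>x. u x * v x)"
proof (rule sq_integrable_bound[OF assms(1)])
  have [measurable]: "u \<in> borel_measurable (lebesgue_on {0..1})" using assms by (auto simp: sq_integrable_def)
  note [measurable] = assms(2)
  show "(\<lambda>x. u x * v x) \<in> borel_measurable (lebesgue_on {0..1})" by measurable
  show "cmod (u x * v x) \<le> C * cmod (u x)" if "x \<in> {0..1}" for x
    using mult_right_mono[OF assms(3)[OF that], of "cmod (u x)"] by (simp add: norm_mult mult.commute)
qed

lemma sq_integrable_mult_continuous:
  assumes "sq_integrable u" "continuous_on {0..1} v"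
  shows "sq_integrable (\<lambda>x. u x * v x)"
proof -
  have "bounded (v ` {0..1})"
    using assms(2) compact_continuous_image compact_imp_bounded by blast
  then obtain C where "\<And>x. x \<in> {0..1} \<Longrightarrow> cmod (v x) \<le> C" unfolding bounded_iff by blast
  then show ?thesis
    using sq_integrable_mult_bounded[OF assms(1), of v C] sq_integrable_continuous[OF assms(2)] by (simp add: sq_integrable_def)
qed

lemma sq_integrable_imp_integrable:
  assumes "sq_integrable u" shows "integrable (lebesgue_on {0..1}) u"
  using sq_integrable_mult(1)[OF assms sq_integrable_continuous[of "\<lambda>_. 1"]] by simp

text \<open>\<open>F\<close> belongs to the Sobolev space of order 1 and \<open>D\<close> is its derivative.  Keeping \<open>D\<close> as a
  parameter allows any representative up to a null set.\<close>

definition has_L2_derivative :: "(real \<Rightarrow> complex) \<Rightarrow> (real \<Rightarrow> complex) \<Rightarrow> bool" where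
  "has_L2_derivative F D \<longleftrightarrow> abs_cont_on {0..1} F \<and>
     (AE x in lebesgue_on {0..1}. (F has_vector_derivative D x) (at x within {0..1})) \<and> sq_integrable D"

lemma has_L2_derivative_continuous: "has_L2_derivative F D \<Longrightarrow> continuous_on {0..1} F"
  by (simp add: has_L2_derivative_def abs_cont_on_continuous_on)

lemma has_L2_derivative_has_integral:
  assumes FD: "has_L2_derivative F D" and ab: "0 \<le> a" "a \<le> b" "b \<le> 1"
  shows "(D has_integral (F b - F a)) {a..b}"
proof -
  have "AE x in lebesgue_on {0..1}. (F has_vector_derivative D x) (at x within {0..1})"
    using FD by (simp add: has_L2_derivative_def)
  then obtain N where N: "{x \<in> space (lebesgue_on {0..1}). \<not> (F has_vector_derivative D x) (at x within {0..1})} \<subseteq> N"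
      "emeasure (lebesgue_on {0..1}) N = 0" "N \<in> sets (lebesgue_on {0..1})"
    by (rule AE_E)
  then have "N \<in> null_sets (lebesgue_on {0..1})" by auto
  then have "N \<in> null_sets lebesgue" by (simp add: null_sets_restrict_space)
  then have "negligible N" by (simp add: negligible_iff_null_sets)
  then show ?thesis
  proof (rule abs_cont_fundamental_theorem_of_calculus[OF ab(2), rotated])
    show "abs_cont_on {a..b} F"
      using FD ab by (auto simp: has_L2_derivative_def intro: abs_cont_on_subset)
    fix x assume "x \<in> {a..b} - N"
    then have "(F has_vector_derivative D x) (at x within {0..1})"
      using subsetD[OF N(1), of x] ab by auto
    then show "(F has_vector_derivative D x) (at x within {a..b})"
      by (rule has_vector_derivative_within_subset) (use ab in auto)
  qed
qed

lemma has_L2_derivative_LINT: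
  assumes "has_L2_derivative F D"
  shows "(LINT x|lebesgue_on {0..1}. D x) = F 1 - F 0"
proof -
  have "integrable (lebesgue_on {0..1}) D"
    using assms by (simp add: has_L2_derivative_def sq_integrable_imp_integrable)
  then have "(LINT x|lebesgue_on {0..1}. D x) = integral {0..1} D"
    by (simp add: lebesgue_integral_eq_integral)
  also have "\<dots> = F 1 - F 0"
    using has_L2_derivative_has_integral[OF assms, of 0 1] by (simp add: integral_unique)
  finally show ?thesis .
qed

lemma has_L2_derivative_mult:
  assumes F: "has_L2_derivative F D" and G: "has_L2_derivative G E"
  shows "has_L2_derivative (\<lambda>x. F x * G x) (\<lambda>x. F x * E x + D x * G x)"
  unfolding has_L2_derivative_def
proof (intro conjI)
  note cont = has_L2_derivative_continuous[OF F] has_L2_derivative_continuous[OF G]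
  show "abs_cont_on {0..1} (\<lambda>x. F x * G x)"
    using assms cont by (intro abs_cont_on_mult)
      (auto simp: has_L2_derivative_def intro!: compact_imp_bounded compact_continuous_image)
  have "AE x in lebesgue_on {0..1}. (F has_vector_derivative D x) (at x within {0..1})"
    "AE x in lebesgue_on {0..1}. (G has_vector_derivative E x) (at x within {0..1})"
    using assms by (auto simp: has_L2_derivative_def)
  then show "AE x in lebesgue_on {0..1}. ((\<lambda>x. F x * G x) has_vector_derivative F x * E x + D x * G x) (at x within {0..1})"
    by eventually_elim (rule has_vector_derivative_mult)
  have "sq_integrable (\<lambda>x. E x * F x + D x * G x)"
    using assms cont by (intro sq_integrable_add sq_integrable_mult_continuous) (auto simp: has_L2_derivative_def)
  then show "sq_integrable (\<lambda>x. F x * E x + D x * G x)" by (simp add: mult.commute)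
qed

text \<open>This puts the exponentials and all derivatives of a Sobolev function except the last one under the
  same notion.\<close>

lemma has_L2_derivative_C1:
  assumes D: "\<And>x. x \<in> {0..1} \<Longrightarrow> (F has_vector_derivative D x) (at x within {0..1})" and cont: "continuous_on {0..1} D"
  shows "has_L2_derivative F D"
  unfolding has_L2_derivative_def
proof (intro conjI)
  have "bounded (D ` {0..1})" using cont compact_continuous_image compact_imp_bounded by blast
  then obtain C where C: "\<And>x. x \<in> {0..1} \<Longrightarrow> cmod (D x) \<le> C" unfolding bounded_iff by blast
  show "abs_cont_on {0..1} F"
  proof (rule abs_cont_on_lipschitz[of _ _ C])
    fix x y :: real assume xy: "x \<in> {0..1}" "y \<in> {0..1}"
    have "norm (F y - F x) \<le> C * norm (y - x)"
    proof (rule differentiable_bound)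
      show "convex {0..1::real}" by simp
      show "(F has_derivative (\<lambda>h. h *\<^sub>R D z)) (at z within {0..1})" if "z \<in> {0..1}" for z
        using D[OF that] by (simp add: has_vector_derivative_def)
      show "onorm (\<lambda>h. h *\<^sub>R D z) \<le> C" if "z \<in> {0..1}" for z
        using C[OF that] by (intro onorm_le) (simp add: mult.commute[of C] mult_left_mono)
    qed (use xy in auto)
    then show "norm (F y - F x) \<le> C * \<bar>y - x\<bar>" by simp
  qed
  show "AE x in lebesgue_on {0..1}. (F has_vector_derivative D x) (at x within {0..1})"
    using D by (intro AE_I2) simp
  show "sq_integrable D" by (rule sq_integrable_continuous[OF cont])
qed

section \<open>Fourier coefficients\<close>

text \<open>The complex conjugate of the usual exponential, following the sign convention of \<^const>\<open>fourier_int\<close>.\<close>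

definition wave :: "int \<Rightarrow> real \<Rightarrow> complex" where
  "wave k x = exp (- 2 * of_real pi * \<i> * of_int k * of_real x)"

text \<open>The factor by which differentiation acts on the \<open>k\<close>-th Fourier coefficient of a periodic function.\<close>

definition freq :: "int \<Rightarrow> complex" where
  "freq k = 2 * of_real pi * \<i> * of_int k"

lemma fourier_int_eq: "fourier_int k f = (LINT x|lebesgue_on {0..1}. f x * wave k x)"
  by (simp add: fourier_int_def wave_def)

lemma norm_freq: "cmod (freq k) = 2 * pi * \<bar>real_of_int k\<bar>"
  by (simp add: freq_def norm_mult)

lemma freq_eq_0_iff [simp]: "freq k = 0 \<longleftrightarrow> k = 0"
  by (simp add: freq_def)

lemma freq_minus: "freq (- k) = - freq k"
  by (simp add: freq_def)

lemma freq_mult: "freq (j * k) = of_int k * freq j"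
  by (simp add: freq_def)

lemma wave_cis: "wave k x = cis (- 2 * pi * of_int k * x)"
  by (simp add: wave_def cis_conv_exp mult_ac)

lemma norm_wave [simp]: "cmod (wave k x) = 1"
  by (simp add: wave_cis)

lemma wave_mult: "wave k x * wave j x = wave (k + j) x"
  by (simp add: wave_cis cis_mult algebra_simps)

lemma cnj_wave: "cnj (wave k x) = wave (- k) x"
  by (simp add: wave_cis cis_cnj)

lemma wave_zero [simp]: "wave 0 x = 1"
  by (simp add: wave_cis)

lemma wave_eq_1: 
  assumes "of_int k * x \<in> \<int>" shows "wave k x = 1"
proof -
  obtain n where n: "of_int k * x = of_int n" using assms by (auto elim: Ints_cases)
  have "wave k x = cis (2 * pi * of_int (- n))"
    unfolding wave_cis by (rule arg_cong[of _ _ cis]) (simp add: n[symmetric])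
  also have "\<dots> = 1" by (intro cis_multiple_2pi) auto
  finally show ?thesis .
qed

lemma wave_has_vector_derivative:
  "(wave k has_vector_derivative (- freq k * wave k x)) (at x within S)"
  unfolding wave_def
  by (rule has_vector_derivative_real_field)
     (auto intro!: derivative_eq_intros simp: freq_def)

lemma continuous_on_wave [continuous_intros]: "continuous_on S (wave k)"
  unfolding wave_def by (intro continuous_intros)

lemma wave_has_L2_derivative: "has_L2_derivative (wave k) (\<lambda>x. - freq k * wave k x)"
  by (rule has_L2_derivative_C1, rule wave_has_vector_derivative) (intro continuous_intros)

lemma sq_integrable_wave: "sq_integrable (wave k)"
  by (intro sq_integrable_continuous continuous_intros)

lemma LINT_wave: "(LINT x|lebesgue_on {0..1}. wave k x) = (if k = 0 then 1 else 0)"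
proof (cases "k = 0")
  case False
  have "- freq k * (LINT x|lebesgue_on {0..1}. wave k x) = wave k 1 - wave k 0"
    using has_L2_derivative_LINT[OF wave_has_L2_derivative[of k]] by simp
  also have "\<dots> = 0" by (simp add: wave_eq_1)
  finally show ?thesis using False by simp
qed simp

lemma fourier_int_shift: "fourier_int j (\<lambda>x. f x * wave k x) = fourier_int (k + j) f"
  unfolding fourier_int_eq by (simp add: mult.assoc wave_mult)

lemma fourier_int_derivative:
  assumes "has_L2_derivative F D"
  shows "fourier_int k D = F 1 - F 0 + freq k * fourier_int k F"
proof -
  have sq: "sq_integrable F" "sq_integrable D"
    using assms has_L2_derivative_continuous sq_integrable_continuous by (auto simp: has_L2_derivative_def)
  have "F 1 - F 0 = (LINT x|lebesgue_on {0..1}. F x * (- freq k * wave k x) + D x * wave k x)"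
    using has_L2_derivative_LINT[OF has_L2_derivative_mult[OF assms wave_has_L2_derivative[of k]]]
    by (simp add: wave_eq_1)
  also have "\<dots> = (LINT x|lebesgue_on {0..1}. - freq k * (F x * wave k x) + D x * wave k x)"
    by (simp add: algebra_simps)
  also have "\<dots> = - freq k * fourier_int k F + fourier_int k D"
    unfolding fourier_int_eq
    by (subst Bochner_Integration.integral_add)
       (simp_all add: sq_integrable_mult(1) sq sq_integrable_wave)
  finally show ?thesis by (simp add: algebra_simps)
qed

lemma sq_integrable_trig:
  assumes "finite J" shows "sq_integrable (\<lambda>x. \<Sum>j\<in>J. w j * wave (p j) x)"
  by (intro sq_integrable_continuous continuous_intros)

lemma LINT_times_trig:
  assumes "finite J" "sq_integrable u"
  shows "(LINT x|lebesgue_on {0..1}. u x * (\<Sum>j\<in>J. w j * wave (p j) x)) = (\<Sum>j\<in>J. w j * fourier_int (p j) u)"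
proof -
  have "(LINT x|lebesgue_on {0..1}. u x * (\<Sum>j\<in>J. w j * wave (p j) x))
      = (LINT x|lebesgue_on {0..1}. (\<Sum>j\<in>J. w j * (u x * wave (p j) x)))"
    by (simp add: sum_distrib_left mult_ac)
  also have "\<dots> = (\<Sum>j\<in>J. w j * fourier_int (p j) u)"
    unfolding fourier_int_eq
    by (subst Bochner_Integration.integral_sum)
       (simp_all add: sq_integrable_mult(1) assms sq_integrable_wave)
  finally show ?thesis .
qed

lemma fourier_int_trig:
  assumes "finite J" "inj_on p J" "i \<in> J"
  shows "fourier_int (- p i) (\<lambda>x. \<Sum>j\<in>J. w j * wave (p j) x) = w i"
proof -
  have "fourier_int (- p i) (\<lambda>x. \<Sum>j\<in>J. w j * wave (p j) x) = (\<Sum>j\<in>J. w j * fourier_int (p j) (wave (- p i)))"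
    using LINT_times_trig[OF assms(1) sq_integrable_wave[of "- p i"], of w p] by (simp add: fourier_int_eq mult.commute)
  also have "\<dots> = (\<Sum>j\<in>J. if j = i then w j else 0)"
    using assms by (intro sum.cong) (auto simp: fourier_int_eq wave_mult LINT_wave dest: inj_onD)
  also have "\<dots> = w i" using assms by simp
  finally show ?thesis .
qed

lemma L2norm_sq: "of_real ((L2norm u)\<^sup>2) = (LINT x|lebesgue_on {0..1}. u x * cnj (u x))"
proof -
  have "of_real ((L2norm u)\<^sup>2) = (complex_of_real (LINT x|lebesgue_on {0..1}. (cmod (u x))\<^sup>2))"
    by (simp add: L2norm_def)
  also have "\<dots> = (LINT x|lebesgue_on {0..1}. complex_of_real ((cmod (u x))\<^sup>2))"
    by (rule integral_complex_of_real[symmetric])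
  also have "\<dots> = (LINT x|lebesgue_on {0..1}. u x * cnj (u x))"
    by (simp only: complex_norm_square)
  finally show ?thesis .
qed

lemma L2norm_trig:
  assumes "finite J" "inj_on p J"
  shows "(L2norm (\<lambda>x. \<Sum>j\<in>J. w j * wave (p j) x))\<^sup>2 = (\<Sum>j\<in>J. (cmod (w j))\<^sup>2)"
proof -
  let ?T = "\<lambda>x. \<Sum>j\<in>J. w j * wave (p j) x"
  have "complex_of_real ((L2norm ?T)\<^sup>2) = (LINT x|lebesgue_on {0..1}. ?T x * (\<Sum>j\<in>J. cnj (w j) * wave (- p j) x))"
    unfolding L2norm_sq by (simp add: cnj_wave)
  also have "\<dots> = (\<Sum>j\<in>J. cnj (w j) * fourier_int (- p j) ?T)"
    by (rule LINT_times_trig[OF assms(1) sq_integrable_trig[OF assms(1)]])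
  also have "\<dots> = (\<Sum>j\<in>J. cnj (w j) * w j)"
    by (intro sum.cong refl) (simp add: fourier_int_trig[OF assms])
  also have "\<dots> = of_real (\<Sum>j\<in>J. (cmod (w j))\<^sup>2)"
    by (simp only: of_real_sum complex_norm_square mult.commute)
  finally show ?thesis by (simp only: of_real_eq_iff)
qed

text \<open>The dual form of Bessel's inequality: the left-hand side is the integral of \<open>u\<close> against a
  trigonometric polynomial, whose \<open>L\<^sub>2\<close> norm is known by orthonormality.\<close>

lemma fourier_sum_bound:
  assumes "finite J" "inj_on p J" "sq_integrable u"
  shows "cmod (\<Sum>j\<in>J. w j * fourier_int (p j) u) \<le> sqrt (\<Sum>j\<in>J. (cmod (w j))\<^sup>2) * L2norm u"
proof -
  have "cmod (\<Sum>j\<in>J. w j * fourier_int (p j) u) \<le> L2norm u * L2norm (\<lambda>x. \<Sum>j\<in>J. w j * wave (p j) x)"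
    unfolding LINT_times_trig[OF assms(1,3), symmetric]
    by (rule sq_integrable_mult(2)[OF assms(3) sq_integrable_trig[OF assms(1)]])
  also have "L2norm (\<lambda>x. \<Sum>j\<in>J. w j * wave (p j) x) = sqrt (\<Sum>j\<in>J. (cmod (w j))\<^sup>2)"
    unfolding L2norm_trig[OF assms(1,2), of w, symmetric] by simp
  finally show ?thesis by (simp add: mult.commute)
qed

lemma sq_integrable_cnj: "sq_integrable u \<Longrightarrow> sq_integrable (\<lambda>x. cnj (u x))"
  unfolding sq_integrable_def by (auto intro: borel_measurable_continuous_onI measurable_compose intro!: continuous_intros)

text \<open>Since \<open>S\<close> is the orthogonal projection of \<open>u\<close>, all three mixed integrals \<open>\<langle>u,S\<rangle>\<close>, \<open>\<langle>S,u\<rangle>\<close>, \<open>\<langle>S,S\<rangle>\<close>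
  equal the sum of the squared coefficients.  The sign in \<open>- p j\<close> arises because \<^const>\<open>wave\<close> is the
  conjugate exponential.\<close>

lemma L2norm_fourier_remainder:
  assumes "finite J" "inj_on p J" "sq_integrable u"
  shows "(L2norm (\<lambda>x. u x - (\<Sum>j\<in>J. fourier_int (- p j) u * wave (p j) x)))\<^sup>2
     = (L2norm u)\<^sup>2 - (\<Sum>j\<in>J. (cmod (fourier_int (- p j) u))\<^sup>2)"
proof -
  define S where "S = (\<lambda>x. \<Sum>j\<in>J. fourier_int (- p j) u * wave (p j) x)"
  have S: "sq_integrable S" unfolding S_def by (rule sq_integrable_trig[OF assms(1)])
  note int = sq_integrable_mult(1)
  have uS: "(LINT x|lebesgue_on {0..1}. u x * cnj (S x)) = of_real (\<Sum>j\<in>J. (cmod (fourier_int (- p j) u))\<^sup>2)"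
  proof -
    have "(LINT x|lebesgue_on {0..1}. u x * cnj (S x))
       = (LINT x|lebesgue_on {0..1}. u x * (\<Sum>j\<in>J. cnj (fourier_int (- p j) u) * wave (- p j) x))"
      by (simp add: S_def cnj_wave)
    also have "\<dots> = (\<Sum>j\<in>J. cnj (fourier_int (- p j) u) * fourier_int (- p j) u)"
      by (rule LINT_times_trig[OF assms(1,3)])
    also have "\<dots> = of_real (\<Sum>j\<in>J. (cmod (fourier_int (- p j) u))\<^sup>2)"
      by (simp only: of_real_sum complex_norm_square mult.commute)
    finally show ?thesis .
  qed
  have Su: "(LINT x|lebesgue_on {0..1}. S x * cnj (u x)) = of_real (\<Sum>j\<in>J. (cmod (fourier_int (- p j) u))\<^sup>2)"
  proof -
    have "(LINT x|lebesgue_on {0..1}. S x * cnj (u x)) = (LINT x|lebesgue_on {0..1}. cnj (u x * cnj (S x)))"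
      by (simp add: mult.commute)
    also have "\<dots> = cnj (LINT x|lebesgue_on {0..1}. u x * cnj (S x))"
      by (rule Bochner_Integration.integral_cnj)
    finally show ?thesis by (simp add: uS)
  qed
  have SS: "(LINT x|lebesgue_on {0..1}. S x * cnj (S x)) = of_real (\<Sum>j\<in>J. (cmod (fourier_int (- p j) u))\<^sup>2)"
    unfolding L2norm_sq[symmetric] S_def L2norm_trig[OF assms(1,2)] ..
  have "complex_of_real ((L2norm (\<lambda>x. u x - S x))\<^sup>2)
     = (LINT x|lebesgue_on {0..1}. (u x * cnj (u x) - u x * cnj (S x)) - (S x * cnj (u x) - S x * cnj (S x)))"
    unfolding L2norm_sq by (simp add: algebra_simps)
  also have "\<dots> = ((LINT x|lebesgue_on {0..1}. u x * cnj (u x)) - (LINT x|lebesgue_on {0..1}. u x * cnj (S x)))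
       - ((LINT x|lebesgue_on {0..1}. S x * cnj (u x)) - (LINT x|lebesgue_on {0..1}. S x * cnj (S x)))"
    using assms(3) S by (simp add: int sq_integrable_cnj Bochner_Integration.integral_diff Bochner_Integration.integrable_diff)
  also have "\<dots> = of_real ((L2norm u)\<^sup>2 - (\<Sum>j\<in>J. (cmod (fourier_int (- p j) u))\<^sup>2))"
    unfolding uS Su SS L2norm_sq[symmetric] by simp
  finally show ?thesis unfolding S_def by (simp only: of_real_eq_iff)
qed

section \<open>Aliasing for the trapezoidal rule\<close>

lemma has_integral_unit_pieces:
  fixes g :: "real \<Rightarrow> 'a::banach"
  assumes "N \<ge> 1" and piece: "\<And>j. j < N \<Longrightarrow> (g has_integral I j) {real j / real N..real (Suc j) / real N}"
  shows "(g has_integral (\<Sum>j<N. I j)) {0..1}"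
proof -
  have "(g has_integral (\<Sum>j<n. I j)) {0..real n / real N}" if "n \<le> N" for n
    using that
  proof (induction n)
    case (Suc n)
    have "(g has_integral (\<Sum>j<n. I j) + I n) {0..real (Suc n) / real N}"
      by (rule has_integral_combine[of _ "real n / real N"])
         (use Suc piece[of n] in \<open>auto simp: divide_right_mono\<close>)
    then show ?case by simp
  qed auto
  from this[of N] show ?thesis using assms(1) by simp
qed

text \<open>The Peano kernel of the trapezoidal rule with \<open>N\<close> panels, up to the factor \<open>N\<close>.\<close>

definition sawtooth :: "nat \<Rightarrow> real \<Rightarrow> complex" where
  "sawtooth N x = of_real (frac (real N * x) - 1/2)"

lemma norm_sawtooth: "cmod (sawtooth N x) \<le> 1"
  unfolding sawtooth_def norm_of_real using frac_ge_0[of "real N * x"] frac_lt_1[of "real N * x"] by linarith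

lemma sawtooth_measurable [measurable]: "sawtooth N \<in> borel_measurable (lebesgue_on {0..1})"
proof -
  have "sawtooth N \<in> borel_measurable borel" unfolding sawtooth_def[abs_def] frac_def by measurable
  then have "sawtooth N \<in> borel_measurable lborel" by simp
  then show ?thesis by (intro measurable_restrict_space1 measurable_completion)
qed

lemma sq_integrable_sawtooth: "sq_integrable (sawtooth N)"
  using sq_integrable_mult_bounded[of "\<lambda>_. 1" "sawtooth N" 1] norm_sawtooth by (simp add: sq_integrable_continuous)

lemma sawtooth_piece:
  assumes "N \<ge> 1" "x \<in> {real j / real N..real (Suc j) / real N} - {real (Suc j) / real N}"
  shows "sawtooth N x = of_real (real N * x - real j - 1/2)"
proof -
  have "real j \<le> real N * x" "real N * x < real j + 1"
    using assms by (auto simp: field_simps)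
  then have "\<lfloor>real N * x\<rfloor> = int j" by (simp add: floor_unique)
  then show ?thesis by (simp add: sawtooth_def frac_def)
qed

definition trapezoid :: "nat \<Rightarrow> (real \<Rightarrow> complex) \<Rightarrow> complex" where
  "trapezoid N f = (\<Sum>j<N. f (real j / real N) + f (real (Suc j) / real N)) / (2 * of_nat N)"

text \<open>Integration by parts on each panel: there the sawtooth is a linear function with slope \<open>N\<close> and end values
  \<open>-1/2\<close> and \<open>1/2\<close>, so the boundary terms are the trapezoidal weights.\<close>

lemma trapezoid_error:
  assumes N: "N \<ge> 1" and FD: "has_L2_derivative F D"
  shows "(LINT x|lebesgue_on {0..1}. D x * sawtooth N x) = of_nat N * (trapezoid N F - (LINT x|lebesgue_on {0..1}. F x))"
proof -
  have sq: "sq_integrable F" "sq_integrable D"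
    using FD has_L2_derivative_continuous sq_integrable_continuous by (auto simp: has_L2_derivative_def)
  have iF: "integrable (lebesgue_on {0..1}) F" by (rule sq_integrable_imp_integrable[OF sq(1)])
  have iD: "integrable (lebesgue_on {0..1}) (\<lambda>x. D x * sawtooth N x)" by (rule sq_integrable_mult(1)[OF sq(2) sq_integrable_sawtooth])
  have "((\<lambda>x. F x * of_nat N + D x * sawtooth N x) has_integral
      (\<Sum>j<N. (F (real j / real N) + F (real (Suc j) / real N)) / 2)) {0..1}"
  proof (rule has_integral_unit_pieces[OF N])
    fix j assume j: "j < N"
    define a b where "a = real j / real N" and "b = real (Suc j) / real N"
    have ab: "0 \<le> a" "a \<le> b" "b \<le> 1" "real N * a = real j" "real N * b = real j + 1"
      using j by (auto simp: a_def b_def field_simps)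
    have "has_L2_derivative (\<lambda>x. complex_of_real (real N * x - real j - 1/2)) (\<lambda>x. of_nat N)"
    proof (rule has_L2_derivative_C1)
      fix x :: real
      have "((\<lambda>x. real N * x - real j - 1/2) has_real_derivative real N) (at x within {0..1})"
        by (auto intro!: derivative_eq_intros)
      from has_vector_derivative_of_real[OF this, where 'a = complex]
      show "((\<lambda>x. complex_of_real (real N * x - real j - 1/2)) has_vector_derivative of_nat N) (at x within {0..1})"
        by simp
    qed simp
    from has_L2_derivative_has_integral[OF has_L2_derivative_mult[OF FD this] ab(1-3)]
    have "((\<lambda>x. F x * of_nat N + D x * of_real (real N * x - real j - 1/2)) has_integral
        (F a + F b) / 2) {a..b}"
      unfolding ab(4,5) by (simp add: field_simps)
    then have "((\<lambda>x. F x * of_nat N + D x * sawtooth N x) has_integral (F a + F b) / 2) {a..b}"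
      by (rule has_integral_spike_finite[of "{b}", rotated 2])
         (use sawtooth_piece[OF N] in \<open>auto simp: a_def b_def\<close>)
    then show "((\<lambda>x. F x * of_nat N + D x * sawtooth N x) has_integral
       (F (real j / real N) + F (real (Suc j) / real N)) / 2) {real j / real N..real (Suc j) / real N}"
      by (simp add: a_def b_def)
  qed
  then have "(LINT x|lebesgue_on {0..1}. F x * of_nat N + D x * sawtooth N x)
     = (\<Sum>j<N. (F (real j / real N) + F (real (Suc j) / real N)) / 2)"
    using iF iD by (subst lebesgue_integral_eq_integral) (auto simp: integral_unique)
  also have "(LINT x|lebesgue_on {0..1}. F x * of_nat N + D x * sawtooth N x)
     = (LINT x|lebesgue_on {0..1}. F x) * of_nat N + (LINT x|lebesgue_on {0..1}. D x * sawtooth N x)"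
    using iF iD by simp
  also have "(\<Sum>j<N. (F (real j / real N) + F (real (Suc j) / real N)) / 2) = of_nat N * trapezoid N F"
    using N by (simp add: trapezoid_def sum_divide_distrib[symmetric])
  finally show ?thesis by (simp add: algebra_simps)
qed

text \<open>The error formula for the trapezoidal rule, applied to an exponential whose frequency is a multiple of
  \<open>N\<close>: the rule sees the constant 1, while the integral vanishes.\<close>

lemma fourier_int_sawtooth:
  assumes N: "N \<ge> 1" and j: "j \<noteq> 0"
  shows "fourier_int (j * int N) (sawtooth N) = - 1 / freq j"
proof -
  have w1: "wave (j * int N) (real i / real N) = 1" for i
    using N by (intro wave_eq_1) simp
  have "(LINT x|lebesgue_on {0..1}. - freq (j * int N) * wave (j * int N) x * sawtooth N x)
     = of_nat N * (trapezoid N (wave (j * int N)) - (LINT x|lebesgue_on {0..1}. wave (j * int N) x))"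
    by (rule trapezoid_error[OF N wave_has_L2_derivative])
  also have "trapezoid N (wave (j * int N)) = 1"
    unfolding trapezoid_def w1 using N by simp
  also have "(LINT x|lebesgue_on {0..1}. - freq (j * int N) * wave (j * int N) x * sawtooth N x)
     = - freq (j * int N) * fourier_int (j * int N) (sawtooth N)"
    unfolding fourier_int_eq by (subst integral_mult_right_zero[symmetric]) (simp add: mult_ac)
  finally have *: "- freq (j * int N) * fourier_int (j * int N) (sawtooth N) = of_nat N"
    using j N by (simp add: LINT_wave)
  have "of_nat N * (freq j * fourier_int (j * int N) (sawtooth N) + 1)
      = of_nat N - (- freq (j * int N) * fourier_int (j * int N) (sawtooth N))"
    by (simp add: freq_mult algebra_simps)
  also have "\<dots> = 0" unfolding * by simp
  finally have "freq j * fourier_int (j * int N) (sawtooth N) = - 1"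
    using N by (simp add: add_eq_0_iff2)
  then show ?thesis using j by (simp add: field_simps)
qed

lemma L2norm_sawtooth:
  assumes N: "N \<ge> 1" shows "(L2norm (sawtooth N))\<^sup>2 = 1 / 12"
proof -
  have "((\<lambda>x. (cmod (sawtooth N x))\<^sup>2) has_integral (\<Sum>j<N. 1 / (12 * real N))) {0..1}"
  proof (rule has_integral_unit_pieces[OF N])
    fix j assume j: "j < N"
    define a b where "a = real j / real N" and "b = real (Suc j) / real N"
    have ab: "0 \<le> a" "a \<le> b" "b \<le> 1" "real N * a = real j" "real N * b = real j + 1"
      using j by (auto simp: a_def b_def field_simps)
    have "((\<lambda>x. (real N * x - real j - 1/2)\<^sup>2) has_integral
       (real N * b - real j - 1/2)^3 / (3 * real N) - (real N * a - real j - 1/2)^3 / (3 * real N)) {a..b}"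
      by (rule fundamental_theorem_of_calculus[OF ab(2)])
         (use N in \<open>auto intro!: derivative_eq_intros simp flip: has_real_derivative_iff_has_vector_derivative\<close>)
    then have "((\<lambda>x. (real N * x - real j - 1/2)\<^sup>2) has_integral 1 / (12 * real N)) {a..b}"
      unfolding ab(4,5) by (simp add: field_simps power3_eq_cube)
    then have "((\<lambda>x. (cmod (sawtooth N x))\<^sup>2) has_integral 1 / (12 * real N)) {a..b}"
      by (rule has_integral_spike_finite[of "{b}", rotated 2])
         (use sawtooth_piece[OF N, of _ j] in \<open>auto simp: a_def b_def simp del: of_real_diff\<close>)
    then show "((\<lambda>x. (cmod (sawtooth N x))\<^sup>2) has_integral 1 / (12 * real N)) {real j / real N..real (Suc j) / real N}"
      by (simp add: a_def b_def)
  qed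
  then have "(LINT x|lebesgue_on {0..1}. (cmod (sawtooth N x))\<^sup>2) = (\<Sum>j<N. 1 / (12 * real N))"
    using sq_integrable_sawtooth[of N] by (subst lebesgue_integral_eq_integral) (auto simp: integral_unique sq_integrable_def)
  then show ?thesis using N by (simp add: L2norm_def)
qed

text \<open>The sums over frequencies are in general only conditionally convergent, so they are taken over
  symmetric ranges.\<close>

definition punctured :: "nat \<Rightarrow> int set" where
  "punctured M = {- int M..int M} - {0}"

lemma finite_punctured [simp]: "finite (punctured M)" by (simp add: punctured_def)

lemma sum_punctured: "(\<Sum>j\<in>punctured M. g j) = (\<Sum>n<M. g (int (Suc n)) + g (- int (Suc n)))"
proof (induction M)
  case (Suc M)
  have "punctured (Suc M) = insert (int (Suc M)) (insert (- int (Suc M)) (punctured M))"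
    by (auto simp: punctured_def)
  then show ?case using Suc by (simp add: punctured_def add_ac)
qed (simp add: punctured_def)

text \<open>The squared \<open>L\<^sub>2\<close> distance from the sawtooth to its \<open>M\<close>-th Fourier sum is
  \<open>1/12 - (1/(2\<pi>\<^sup>2)) (\<Sum>n=1..M. 1/n\<^sup>2)\<close>.  It tends to 0 by the evaluation of \<open>\<Sum> 1/n\<^sup>2\<close> as \<open>\<pi>\<^sup>2/6\<close>,
  and Cauchy--Schwarz transfers this to the integral against \<open>u\<close>.\<close>

lemma sawtooth_fourier_series:
  assumes N: "N \<ge> 1" and u: "sq_integrable u"
  shows "(\<lambda>M. \<Sum>j\<in>punctured M. fourier_int (j * int N) u / freq j) \<longlonglongrightarrow> (LINT x|lebesgue_on {0..1}. u x * sawtooth N x)"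
proof -
  let ?p = "\<lambda>j. j * int N"
  have inj: "inj_on ?p (punctured M)" for M using N by (auto simp: inj_on_def)
  have coef: "fourier_int (- ?p j) (sawtooth N) = 1 / freq j" if "j \<in> punctured M" for j M
    using fourier_int_sawtooth[OF N, of "- j"] that by (auto simp: punctured_def freq_minus)
  \<comment> \<open>the remainder of the Fourier series of the sawtooth\<close>
  define R where "R M = (\<lambda>x. sawtooth N x - (\<Sum>j\<in>punctured M. fourier_int (- ?p j) (sawtooth N) * wave (?p j) x))" for M
  have Rsq: "sq_integrable (R M)" for M
    using sq_integrable_add[OF sq_integrable_sawtooth[of N] sq_integrable_trig[of "punctured M" "\<lambda>j. - fourier_int (- ?p j) (sawtooth N)" ?p]]
    by (simp add: R_def sum_negf)
  have "(\<lambda>M. (\<Sum>n<M. 1 / (real n + 1)\<^sup>2)) \<longlonglongrightarrow> pi\<^sup>2 / 6"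
    using inverse_squares_sums by (simp add: sums_def add.commute)
  then have "(\<lambda>M. 1 / 12 - (\<Sum>n<M. 1 / (real n + 1)\<^sup>2) * (1 / (2 * pi\<^sup>2))) \<longlonglongrightarrow> 1 / 12 - pi\<^sup>2 / 6 * (1 / (2 * pi\<^sup>2))"
    by (intro tendsto_intros)
  moreover have "(L2norm (R M))\<^sup>2 = 1 / 12 - (\<Sum>n<M. 1 / (real n + 1)\<^sup>2) * (1 / (2 * pi\<^sup>2))" for M
  proof -
    have "(L2norm (R M))\<^sup>2 = 1 / 12 - (\<Sum>j\<in>punctured M. (cmod (fourier_int (- ?p j) (sawtooth N)))\<^sup>2)"
      unfolding R_def L2norm_fourier_remainder[OF finite_punctured inj sq_integrable_sawtooth] L2norm_sawtooth[OF N] ..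
    also have "(\<Sum>j\<in>punctured M. (cmod (fourier_int (- ?p j) (sawtooth N)))\<^sup>2) = (\<Sum>j\<in>punctured M. 1 / (2 * pi * \<bar>real_of_int j\<bar>)\<^sup>2)"
      by (intro sum.cong refl) (simp add: coef norm_divide norm_freq power_divide)
    also have "\<dots> = (\<Sum>n<M. 1 / (real n + 1)\<^sup>2) * (1 / (2 * pi\<^sup>2))"
      unfolding sum_punctured sum_distrib_right
    proof (intro sum.cong refl)
      fix n
      have a: "\<bar>real_of_int (int (Suc n))\<bar> = real n + 1" "\<bar>real_of_int (- int (Suc n))\<bar> = real n + 1"
        by simp_all
      have b: "1 / (2 * c * y)\<^sup>2 + 1 / (2 * c * y)\<^sup>2 = 1 / y\<^sup>2 * (1 / (2 * c\<^sup>2))" for c y :: real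
        by (simp add: power2_eq_square)
      show "1 / (2 * pi * \<bar>real_of_int (int (Suc n))\<bar>)\<^sup>2 + 1 / (2 * pi * \<bar>real_of_int (- int (Suc n))\<bar>)\<^sup>2
          = 1 / (real n + 1)\<^sup>2 * (1 / (2 * pi\<^sup>2))"
        unfolding a by (rule b)
    qed
    finally show ?thesis .
  qed
  ultimately have "(\<lambda>M. (L2norm (R M))\<^sup>2) \<longlonglongrightarrow> 0" by simp
  then have "(\<lambda>M. sqrt ((L2norm (R M))\<^sup>2)) \<longlonglongrightarrow> sqrt 0" by (rule tendsto_real_sqrt)
  then have lim: "(\<lambda>M. L2norm u * L2norm (R M)) \<longlonglongrightarrow> 0" by (simp add: tendsto_mult_right_zero)
  have eq: "(LINT x|lebesgue_on {0..1}. u x * sawtooth N x) - (\<Sum>j\<in>punctured M. fourier_int (j * int N) u / freq j)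
      = (LINT x|lebesgue_on {0..1}. u x * R M x)" for M
  proof -
    have "(\<Sum>j\<in>punctured M. fourier_int (j * int N) u / freq j) = (\<Sum>j\<in>punctured M. fourier_int (- ?p j) (sawtooth N) * fourier_int (?p j) u)"
      by (intro sum.cong refl) (simp add: coef)
    also have "\<dots> = (LINT x|lebesgue_on {0..1}. u x * (\<Sum>j\<in>punctured M. fourier_int (- ?p j) (sawtooth N) * wave (?p j) x))"
      by (rule LINT_times_trig[symmetric]) (auto simp: u)
    finally show ?thesis
      unfolding R_def
      by (simp add: right_diff_distrib Bochner_Integration.integral_diff sq_integrable_mult(1) u sq_integrable_sawtooth sq_integrable_trig)
  qed
  have "(\<lambda>M. (LINT x|lebesgue_on {0..1}. u x * sawtooth N x) - (\<Sum>j\<in>punctured M. fourier_int (j * int N) u / freq j)) \<longlonglongrightarrow> 0"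
  proof (rule Lim_null_comparison[OF always_eventually lim], rule allI)
    show "norm ((LINT x|lebesgue_on {0..1}. u x * sawtooth N x) - (\<Sum>j\<in>punctured M. fourier_int (j * int N) u / freq j))
        \<le> L2norm u * L2norm (R M)" for M
      unfolding eq by (rule sq_integrable_mult(2)[OF u Rsq])
  qed
  from tendsto_diff[OF tendsto_const[of "LINT x|lebesgue_on {0..1}. u x * sawtooth N x"] this] show ?thesis by simp
qed

text \<open>The sawtooth series for \<open>u = F'\<close>, with the Fourier coefficients of \<open>F'\<close> expressed through those of
  \<open>F\<close>.  The boundary term \<open>F 1 - F 0\<close> meets \<open>\<Sum> 1 / freq j\<close>, which vanishes by symmetry, so the formula
  holds for non-periodic \<open>F\<close> as well.\<close>

theorem trapezoid_aliasing:
  assumes N: "N \<ge> 1" and FD: "has_L2_derivative F D"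
  shows "(\<lambda>M. \<Sum>j\<in>punctured M. fourier_int (j * int N) F) \<longlonglongrightarrow> trapezoid N F - (LINT x|lebesgue_on {0..1}. F x)"
proof -
  have sq: "sq_integrable D" using FD by (simp add: has_L2_derivative_def)
  have "(\<Sum>j\<in>punctured M. fourier_int (j * int N) D / freq j) = of_nat N * (\<Sum>j\<in>punctured M. fourier_int (j * int N) F)" for M
  proof -
    have "(\<Sum>j\<in>punctured M. fourier_int (j * int N) D / freq j)
        = (\<Sum>j\<in>punctured M. (F 1 - F 0) * (1 / freq j) + of_nat N * fourier_int (j * int N) F)"
      by (intro sum.cong refl) (auto simp: punctured_def fourier_int_derivative[OF FD] freq_mult add_divide_distrib)
    also have "\<dots> = (F 1 - F 0) * (\<Sum>j\<in>punctured M. 1 / freq j) + of_nat N * (\<Sum>j\<in>punctured M. fourier_int (j * int N) F)"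
      by (simp add: sum.distrib sum_distrib_left)
    also have "(\<Sum>j\<in>punctured M. 1 / freq j) = 0"
      unfolding sum_punctured freq_minus by simp
    finally show ?thesis by simp
  qed
  with sawtooth_fourier_series[OF N sq] have "(\<lambda>M. of_nat N * (\<Sum>j\<in>punctured M. fourier_int (j * int N) F))
      \<longlonglongrightarrow> of_nat N * (trapezoid N F - (LINT x|lebesgue_on {0..1}. F x))"
    by (simp add: trapezoid_error[OF N FD])
  from tendsto_mult[OF tendsto_const[of "1 / of_nat N"] this] show ?thesis using N by simp
qed

section \<open>Sobolev functions and algorithms using end point derivatives\<close>

lemma nderiv_0 [simp]: "nderiv 0 f = f"
  by (simp add: nderiv_def)

lemma nderiv_Suc: "nderiv (Suc l) f x = vector_derivative (nderiv l f) (at x within {0..1})"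
  by (simp add: nderiv_def)

lemma sobolev_has_L2_derivative:
  assumes f: "f \<in> sobolev s" and l: "l < s"
  shows "has_L2_derivative (nderiv l f) (nderiv (Suc l) f)"
proof (cases "Suc l = s")
  case True
  then have s1: "s - 1 = l" by simp
  have "AE x in lebesgue_on {0..1}. nderiv l f differentiable (at x within {0..1})" "abs_cont_on {0..1} (nderiv l f)"
    using f unfolding sobolev_def s1 by auto
  moreover have "sq_integrable (nderiv (Suc l) f)"
    using f True by (simp add: sobolev_def sq_integrable_def)
  ultimately show ?thesis
    unfolding has_L2_derivative_def nderiv_Suc vector_derivative_works[symmetric] by blast
next
  case False
  with l have l2: "Suc l < s" by simp
  show ?thesis
  proof (rule has_L2_derivative_C1)
    show "(nderiv l f has_vector_derivative nderiv (Suc l) f x) (at x within {0..1})" if "x \<in> {0..1}" for x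
      using f l2 that unfolding nderiv_Suc vector_derivative_works[symmetric] by (auto simp: sobolev_def)
    show "continuous_on {0..1} (nderiv (Suc l) f)"
    proof (cases "Suc (Suc l) = s")
      case True
      then have "Suc l = s - 1" by simp
      then show ?thesis using f by (auto simp: sobolev_def intro: abs_cont_on_continuous_on)
    next
      case False
      with l2 have "Suc (Suc l) < s" by simp
      then have "\<forall>x\<in>{0..1}. nderiv (Suc l) f differentiable (at x within {0..1})"
        using f by (auto simp: sobolev_def)
      then show ?thesis
        by (simp add: continuous_on_eq_continuous_within differentiable_imp_continuous_within)
    qed
  qed
qed

lemma sobolev_sq_integrable: "f \<in> sobolev s \<Longrightarrow> sq_integrable (nderiv s f)"
  by (simp add: sobolev_def sq_integrable_def)

text \<open>The mean of the next derivative, and the obstruction to periodicity of \<open>f\<close> at order \<open>l\<close>.\<close>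

definition jump :: "nat \<Rightarrow> (real \<Rightarrow> complex) \<Rightarrow> complex" where
  "jump l f = nderiv l f 1 - nderiv l f 0"

lemma fourier_int_parts:
  assumes f: "f \<in> sobolev s" and m: "m \<le> s" and p: "p \<noteq> 0"
  shows "fourier_int p f = fourier_int p (nderiv m f) / freq p ^ m - (\<Sum>l<m. jump l f / freq p ^ Suc l)"
  using m
proof (induction m)
  case (Suc m)
  have "fourier_int p (nderiv m f) = (fourier_int p (nderiv (Suc m) f) - jump m f) / freq p"
    using fourier_int_derivative[OF sobolev_has_L2_derivative[OF f, of m], of p] Suc.prems p
    by (simp add: jump_def)
  then show ?case using Suc p by (simp add: diff_divide_distrib)
qed simp

lemma sob_norm_eq:
  "sob_norm s f = sqrt ((\<Sum>l<s. (cmod (LINT x|lebesgue_on {0..1}. nderiv l f x))\<^sup>2) + (L2norm (nderiv s f))\<^sup>2)"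
proof -
  have "sob_inner s f f = of_real ((\<Sum>l<s. (cmod (LINT x|lebesgue_on {0..1}. nderiv l f x))\<^sup>2) + (L2norm (nderiv s f))\<^sup>2)"
    unfolding sob_inner_def Bochner_Integration.integral_cnj of_real_add of_real_sum L2norm_sq complex_norm_square ..
  then show ?thesis by (simp add: sob_norm_def)
qed

lemma L2norm_le_sob_norm: "L2norm (nderiv s f) \<le> sob_norm s f"
  unfolding sob_norm_eq by (rule real_le_rsqrt) (simp add: sum_nonneg)

lemma cmod_fourier_int_le: 
  assumes "sq_integrable u" shows "cmod (fourier_int k u) \<le> L2norm u"
  using fourier_sum_bound[of "{k}" "\<lambda>j. j" u "\<lambda>_. 1"] assms by simp

lemma sum_lessThan_add: "(\<Sum>j<a + b. g j) = (\<Sum>j<a. g j) + (\<Sum>j<b. g (a + j :: nat))" for g :: "nat \<Rightarrow> 'a::comm_monoid_add"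
  by (induction b) (simp_all add: add.assoc)

text \<open>The shape of all algorithms used below: all derivatives at both end points, and \<open>m\<close> function values.\<close>

lemma end_point_algorithm:
  assumes "s \<ge> 1" and y: "\<And>i. i < m \<Longrightarrow> y i \<in> {0..1}"
  shows "(\<lambda>f. (\<Sum>l<s. \<alpha> l * nderiv l f 0) + (\<Sum>l<s. \<beta> l * nderiv l f 1) + (\<Sum>i<m. \<gamma> i * f (y i)))
    \<in> algorithms (2 * s + m) s"
proof -
  define a where "a j = (if j < s then \<alpha> j else if j < 2 * s then \<beta> (j - s) else \<gamma> (j - 2 * s))" for j
  define l where "l j = (if j < s then j else if j < 2 * s then j - s else 0)" for j
  define x where "x j = (if j < s then 0 else if j < 2 * s then 1 else y (j - 2 * s))" for j
  have "(\<Sum>j<2 * s + m. a j * nderiv (l j) f (x j))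
     = (\<Sum>l<s. \<alpha> l * nderiv l f 0) + (\<Sum>l<s. \<beta> l * nderiv l f 1) + (\<Sum>i<m. \<gamma> i * f (y i))" for f
  proof -
    have "(\<Sum>j<2 * s + m. a j * nderiv (l j) f (x j)) =
       (\<Sum>j<s. a j * nderiv (l j) f (x j)) + (\<Sum>j<s. a (s + j) * nderiv (l (s + j)) f (x (s + j)))
       + (\<Sum>j<m. a (2 * s + j) * nderiv (l (2 * s + j)) f (x (2 * s + j)))"
      unfolding sum_lessThan_add mult_2 ..
    moreover have "(\<Sum>j<s. a j * nderiv (l j) f (x j)) = (\<Sum>l<s. \<alpha> l * nderiv l f 0)"
      by (intro sum.cong) (auto simp: a_def l_def x_def)
    moreover have "(\<Sum>j<s. a (s + j) * nderiv (l (s + j)) f (x (s + j))) = (\<Sum>l<s. \<beta> l * nderiv l f 1)"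
      by (intro sum.cong) (auto simp: a_def l_def x_def)
    moreover have "(\<Sum>j<m. a (2 * s + j) * nderiv (l (2 * s + j)) f (x (2 * s + j))) = (\<Sum>i<m. \<gamma> i * f (y i))"
      by (intro sum.cong) (auto simp: a_def l_def x_def)
    ultimately show ?thesis by simp
  qed
  moreover have "\<forall>j<2 * s + m. l j < s \<and> x j \<in> {0..1}"
  proof (intro allI impI)
    fix j assume j: "j < 2 * s + m"
    show "l j < s \<and> x j \<in> {0..1}"
      using y[of "j - 2 * s"] j assms(1) by (auto simp: l_def x_def)
  qed
  ultimately show ?thesis unfolding algorithms_def
    by (intro CollectI exI[of _ a] exI[of _ l] exI[of _ x]) auto
qed

lemma err_le:
  assumes "A \<in> algorithms n s" "\<And>f. f \<in> sobolev s \<Longrightarrow> sob_norm s f \<le> 1 \<Longrightarrow> cmod (fourier_int k f - A f) \<le> C"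
  shows "err n k s \<le> ennreal C"
  unfolding err_def min_error_def
  by (rule INF_lower2[OF assms(1)]) (auto intro!: SUP_least ennreal_leI assms(2))

text \<open>Subtracting the end point terms of the integration by parts formula leaves
  \<open>I\<^sub>k(f\<^sub>s) / \<omega>\<^sub>k\<^sup>s\<close>.  The \<open>m\<close> further values get weight 0; they are there so that this bound can be combined
  with the one for the trapezoidal rule.\<close>

lemma err_end_points:
  assumes "s \<ge> 1" "k \<noteq> 0"
  shows "err (2 * s + m) k s \<le> ennreal ((1 / (2 * pi * \<bar>real_of_int k\<bar>)) ^ s)"
proof (rule err_le[OF end_point_algorithm[OF assms(1)]])
  show "(\<lambda>_. 0) i \<in> {0..1::real}" for i :: nat by simp
  fix f assume f: "f \<in> sobolev s" and n: "sob_norm s f \<le> 1"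
  define A where "A = (\<Sum>l<s. (1 / freq k ^ Suc l) * nderiv l f 0) + (\<Sum>l<s. (- 1 / freq k ^ Suc l) * nderiv l f 1) + (\<Sum>i<m. 0 * f 0)"
  have "A = - (\<Sum>l<s. jump l f / freq k ^ Suc l)"
    unfolding A_def jump_def by (simp add: sum.distrib[symmetric] sum_negf[symmetric] diff_divide_distrib)
  then have "fourier_int k f - A = fourier_int k (nderiv s f) / freq k ^ s"
    using fourier_int_parts[OF f order_refl assms(2)] by simp
  also have "cmod \<dots> \<le> 1 / cmod (freq k) ^ s"
  proof -
    have "cmod (fourier_int k (nderiv s f)) \<le> 1"
      using cmod_fourier_int_le[OF sobolev_sq_integrable[OF f], of k] L2norm_le_sob_norm[of s f] n by linarith
    then show ?thesis by (simp add: norm_divide norm_power divide_right_mono)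
  qed
  also have "\<dots> = (1 / (2 * pi * \<bar>real_of_int k\<bar>)) ^ s"
    by (simp add: norm_freq power_divide)
  finally show "cmod (fourier_int k f - ((\<Sum>l<s. (1 / freq k ^ Suc l) * nderiv l f 0) + (\<Sum>l<s. (- 1 / freq k ^ Suc l) * nderiv l f 1) + (\<Sum>i<m. 0 * f 0)))
    \<le> (1 / (2 * pi * \<bar>real_of_int k\<bar>)) ^ s"
    unfolding A_def .
qed

text \<open>After \<open>|k + jN| \<ge> |j|N - |k|\<close> the claim reduces to \<open>2|k|(|j| + 1) \<le> N(|j| + 1)\<close>.  For \<open>j = -1\<close> and \<open>2k\<close> close to
  \<open>N\<close> it is sharp; this is where the constant 3 in the upper bound comes from.\<close>

lemma alias_frequency_bound:
  fixes k j :: int and N :: nat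
  assumes "2 * \<bar>k\<bar> < int N" "j \<noteq> 0"
  shows "(2 * \<bar>real_of_int j\<bar> - 1) * (real N + \<bar>real_of_int k\<bar>) \<le> 3 * \<bar>real_of_int (k + j * int N)\<bar>"
proof -
  have j: "\<bar>j\<bar> \<ge> 1" using assms(2) by simp
  have "\<bar>j\<bar> * int N - \<bar>k\<bar> \<le> \<bar>k + j * int N\<bar>"
    using abs_triangle_ineq2[of "j * int N" "- k"] by (simp add: abs_mult add.commute)
  moreover have "2 * \<bar>k\<bar> * (\<bar>j\<bar> + 1) \<le> int N * (\<bar>j\<bar> + 1)"
    using assms(1) by (intro mult_right_mono) auto
  ultimately have "(2 * \<bar>j\<bar> - 1) * (int N + \<bar>k\<bar>) \<le> 3 * \<bar>k + j * int N\<bar>"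
    by (simp add: algebra_simps)
  then have "real_of_int ((2 * \<bar>j\<bar> - 1) * (int N + \<bar>k\<bar>)) \<le> real_of_int (3 * \<bar>k + j * int N\<bar>)"
    by (rule of_int_le_iff[THEN iffD2])
  then show ?thesis by simp
qed

lemma norm_alias_freq_ge:
  assumes "2 * \<bar>k\<bar> < int N" "j \<noteq> 0"
  shows "cmod (freq (k + j * int N)) \<ge> \<bar>real_of_int j\<bar>"
proof -
  have j: "\<bar>real_of_int j\<bar> \<ge> 1" using assms(2) by simp
  have N: "real N + \<bar>real_of_int k\<bar> \<ge> 1" using assms(1) by simp
  have "\<bar>real_of_int j\<bar> * 1 \<le> (2 * \<bar>real_of_int j\<bar> - 1) * (real N + \<bar>real_of_int k\<bar>)"
    using j N by (intro mult_mono) auto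
  also have "\<dots> \<le> 3 * \<bar>real_of_int (k + j * int N)\<bar>" by (rule alias_frequency_bound[OF assms])
  also have "\<dots> \<le> (2 * pi) * \<bar>real_of_int (k + j * int N)\<bar>"
    using pi_gt3 by (intro mult_right_mono) auto
  finally show ?thesis by (simp add: norm_freq)
qed

text \<open>The limits are the weights of the end point corrections.  For \<open>l > 0\<close> the series converges absolutely.
  For \<open>l = 0\<close> the terms \<open>j\<close> and \<open>-j\<close> combine to
  \<open>\<omega>\<^bsub>2k\<^esub> / (\<omega>\<^bsub>k+jN\<^esub> \<omega>\<^bsub>k-jN\<^esub>)\<close>, which again decays like \<open>1/j\<^sup>2\<close>.\<close>

lemma alias_sum_convergent:
  assumes k: "2 * \<bar>k\<bar> < int N"
  shows "convergent (\<lambda>M. \<Sum>j\<in>punctured M. 1 / freq (k + j * int N) ^ Suc l)"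
proof -
  let ?g = "\<lambda>j. 1 / freq (k + j * int N) ^ Suc l"
  define C where "C = 2 + cmod (freq (2 * k))"
  have bnd: "norm (?g (int (Suc n)) + ?g (- int (Suc n))) \<le> C * (1 / (real n + 1)\<^sup>2)" for n
  proof -
    let ?u = "freq (k + int (Suc n) * int N)" and ?v = "freq (k + - int (Suc n) * int N)"
    have u: "real n + 1 \<le> cmod ?u" and v: "real n + 1 \<le> cmod ?v"
      using norm_alias_freq_ge[OF k, of "int (Suc n)"] norm_alias_freq_ge[OF k, of "- int (Suc n)"] by simp_all
    have "0 < cmod ?u" "0 < cmod ?v" using u v by linarith+
    then have nz: "?u \<noteq> 0" "?v \<noteq> 0" by (simp_all only: zero_less_norm_iff not_False_eq_True)
    show ?thesis
    proof (cases "l = 0")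
      case True
      have "?g (int (Suc n)) + ?g (- int (Suc n)) = (?u + ?v) / (?u * ?v)"
        using nz True by (simp add: field_simps)
      also have "?u + ?v = freq (2 * k)" by (simp add: freq_def algebra_simps)
      also have "norm (freq (2 * k) / (?u * ?v)) = cmod (freq (2 * k)) / (cmod ?u * cmod ?v)"
        by (simp add: norm_divide norm_mult)
      also have "\<dots> \<le> cmod (freq (2 * k)) / ((real n + 1) * (real n + 1))"
        using u v \<open>0 < cmod ?u\<close> \<open>0 < cmod ?v\<close>
        by (intro divide_left_mono mult_mono mult_pos_pos) (simp_all del: zero_less_norm_iff)
      also have "\<dots> \<le> C / ((real n + 1) * (real n + 1))"
        by (intro divide_right_mono) (auto simp: C_def)
      finally show ?thesis by (simp add: power2_eq_square)
    next
      case False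
      have *: "norm (1 / w ^ Suc l) \<le> 1 / (real n + 1)\<^sup>2" if "real n + 1 \<le> cmod w" for w
      proof -
        have "(real n + 1)\<^sup>2 \<le> (real n + 1) ^ Suc l"
          using False by (intro power_increasing) auto
        also have "\<dots> \<le> cmod w ^ Suc l" using that by (intro power_mono) auto
        finally have "(real n + 1)\<^sup>2 \<le> cmod w ^ Suc l" .
        moreover have "0 < cmod w" using that by linarith
        ultimately show ?thesis
          unfolding norm_divide norm_power norm_one
          by (intro divide_left_mono mult_pos_pos zero_less_power) simp_all
      qed
      have "norm (?g (int (Suc n)) + ?g (- int (Suc n))) \<le> 1 / (real n + 1)\<^sup>2 + 1 / (real n + 1)\<^sup>2"
        by (rule norm_triangle_le) (intro add_mono * u v)
      also have "\<dots> = 2 * (1 / (real n + 1)\<^sup>2)" by simp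
      also have "\<dots> \<le> C * (1 / (real n + 1)\<^sup>2)"
        by (intro mult_right_mono) (auto simp: C_def)
      finally show ?thesis .
    qed
  qed
  have "summable (\<lambda>n. C * (1 / (real n + 1)\<^sup>2))"
    using sums_summable[OF inverse_squares_sums] by (intro summable_mult) (simp add: add.commute)
  then have "summable (\<lambda>n. ?g (int (Suc n)) + ?g (- int (Suc n)))"
    by (rule summable_comparison_test'[where N = 0]) (rule bnd)
  then show ?thesis unfolding sum_punctured summable_iff_convergent .
qed

text \<open>From the second term on, the terms are dominated by the telescoping series \<open>\<Sum> 1/(n(n+1))\<close>.\<close>

lemma sum_inverse_odd_squares_le: "(\<Sum>n<M. 1 / (2 * real (Suc n) - 1)\<^sup>2) \<le> 2"
proof -
  have "(\<Sum>n<Suc M. 1 / (2 * real (Suc n) - 1)\<^sup>2) \<le> 2 - 1 / real (Suc M)" for M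
  proof (induction M)
    case (Suc M)
    have "real (Suc M) * real (Suc (Suc M)) \<le> (2 * real (Suc (Suc M)) - 1)\<^sup>2"
      by (simp add: power2_eq_square algebra_simps)
    moreover have "0 < (2 * real (Suc (Suc M)) - 1)\<^sup>2" by (intro zero_less_power) simp
    ultimately have "1 / (2 * real (Suc (Suc M)) - 1)\<^sup>2 \<le> 1 / (real (Suc M) * real (Suc (Suc M)))"
      by (intro divide_left_mono mult_pos_pos) auto
    also have "\<dots> = 1 / real (Suc M) - 1 / real (Suc (Suc M))" by (simp add: field_simps)
    finally show ?case using Suc by simp
  qed simp
  moreover have "(\<Sum>n<M. 1 / (2 * real (Suc n) - 1)\<^sup>2) \<le> (\<Sum>n<Suc M. 1 / (2 * real (Suc n) - 1)\<^sup>2)"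
    by simp
  ultimately show ?thesis by (smt (verit) divide_nonneg_nonneg of_nat_0_le_iff)
qed

text \<open>With \<open>q = 3 / (2\<pi>(N + |k|))\<close> each \<open>1 / |\<omega>\<^bsub>k+jN\<^esub>|\<close> is at most \<open>q / (2|j| - 1)\<close>, and since \<open>s \<ge> 1\<close> the squares
  of \<open>(2|j| - 1)\<^sup>-\<^sup>s\<close> sum to at most \<open>2 \<cdot> 2\<close> over both signs of \<open>j\<close>.\<close>

lemma alias_sum_sq_bound:
  assumes k: "2 * \<bar>k\<bar> < int N" and s: "s \<ge> 1"
  shows "sqrt (\<Sum>j\<in>punctured M. (cmod (1 / freq (k + j * int N) ^ s))\<^sup>2)
      \<le> 2 * (3 / (2 * pi * (real N + \<bar>real_of_int k\<bar>))) ^ s"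
proof -
  define q where "q = 3 / (2 * pi * (real N + \<bar>real_of_int k\<bar>))"
  have Nk: "real N + \<bar>real_of_int k\<bar> > 0" using k by simp
  have q: "q > 0" using Nk by (simp add: q_def)
  have bnd: "(cmod (1 / freq (k + j * int N) ^ s))\<^sup>2 \<le> (q ^ s)\<^sup>2 * (1 / (2 * \<bar>real_of_int j\<bar> - 1)\<^sup>2)" if "j \<in> punctured M" for j
  proof -
    have j: "j \<noteq> 0" using that by (simp add: punctured_def)
    then have t: "2 * \<bar>real_of_int j\<bar> - 1 \<ge> 1" by simp
    let ?t = "2 * \<bar>real_of_int j\<bar> - 1"
    have "?t / q = (?t * (real N + \<bar>real_of_int k\<bar>)) * (2 * pi / 3)" by (simp add: q_def)
    also have "\<dots> \<le> (3 * \<bar>real_of_int (k + j * int N)\<bar>) * (2 * pi / 3)"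
      by (intro mult_right_mono alias_frequency_bound[OF k j]) simp
    also have "\<dots> = cmod (freq (k + j * int N))" by (simp add: norm_freq)
    finally have le: "?t / q \<le> cmod (freq (k + j * int N))" .
    have "cmod (1 / freq (k + j * int N)) \<le> 1 / (?t / q)"
    proof -
      have "0 < ?t / q" using t q by simp
      moreover from this have "0 < cmod (freq (k + j * int N))" using le by linarith
      ultimately show ?thesis
        unfolding norm_divide norm_one using le by (intro divide_left_mono mult_pos_pos) (simp_all del: zero_less_norm_iff)
    qed
    also have "\<dots> = q * (1 / ?t)" by simp
    finally have "cmod (1 / freq (k + j * int N)) ^ s \<le> (q * (1 / ?t)) ^ s"
      by (intro power_mono) auto
    also have "\<dots> = q ^ s * (1 / ?t) ^ s" by (rule power_mult_distrib)
    also have "\<dots> \<le> q ^ s * (1 / ?t) ^ 1"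
      using t q s by (intro mult_left_mono power_decreasing) auto
    finally have "cmod (1 / freq (k + j * int N) ^ s) \<le> q ^ s * (1 / ?t)"
      by (simp add: norm_divide norm_power power_divide)
    then have "(cmod (1 / freq (k + j * int N) ^ s))\<^sup>2 \<le> (q ^ s * (1 / ?t))\<^sup>2"
      by (intro power_mono) auto
    then show ?thesis by (simp add: power_mult_distrib power_divide)
  qed
  have "(\<Sum>j\<in>punctured M. (cmod (1 / freq (k + j * int N) ^ s))\<^sup>2) \<le> (\<Sum>j\<in>punctured M. (q ^ s)\<^sup>2 * (1 / (2 * \<bar>real_of_int j\<bar> - 1)\<^sup>2))"
    by (rule sum_mono[OF bnd])
  also have "\<dots> = 2 * (q ^ s)\<^sup>2 * (\<Sum>n<M. 1 / (2 * real (Suc n) - 1)\<^sup>2)"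
    unfolding sum_punctured sum_distrib_left by (intro sum.cong) auto
  also have "\<dots> \<le> 2 * (q ^ s)\<^sup>2 * 2"
    by (intro mult_left_mono sum_inverse_odd_squares_le) simp
  also have "\<dots> = (2 * q ^ s)\<^sup>2" by (simp add: power_mult_distrib)
  finally show ?thesis
    unfolding q_def[symmetric] by (rule real_le_lsqrt[OF _ , rotated]) (use q in auto)
qed

section \<open>The trapezoidal rule with end point corrections\<close>

text \<open>This separates the two end points, whose values occur among the end point derivatives anyway, from the
  interior nodes: \<open>m + 1\<close> panels cost only \<open>m\<close> additional values.\<close>

lemma trapezoid_nodes:
  "trapezoid (Suc m) f = (f 0 + f 1) / (2 * of_nat (Suc m)) + (\<Sum>i<m. f (real (Suc i) / real (Suc m)) / of_nat (Suc m))"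
proof -
  let ?g = "\<lambda>j. f (real j / real (Suc m))"
  have "(\<Sum>j<Suc m. ?g j + ?g (Suc j)) = (\<Sum>j<Suc m. ?g j) + (\<Sum>j<Suc m. ?g (Suc j))"
    by (rule sum.distrib)
  also have "(\<Sum>j<Suc m. ?g j) = ?g 0 + (\<Sum>j<m. ?g (Suc j))"
    by (rule sum.lessThan_Suc_shift)
  also have "(\<Sum>j<Suc m. ?g (Suc j)) = (\<Sum>j<m. ?g (Suc j)) + ?g (Suc m)"
    by simp
  finally have e: "(\<Sum>j<Suc m. ?g j + ?g (Suc j)) = (f 0 + f 1) + 2 * (\<Sum>j<m. ?g (Suc j))"
    by simp
  show ?thesis
    unfolding trapezoid_def e add_divide_distrib by (simp add: sum_divide_distrib del: of_nat_Suc)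
qed

text \<open>The algorithm is the trapezoidal rule for \<open>f(x) exp(-2\<pi>\<i>kx)\<close> plus \<open>\<Sum>l<s. b l * jump l f\<close>, where \<open>b l\<close> is the
  limit of the sums of \<open>\<omega>\<^bsub>k+jN\<^esub>\<^sup>-\<^sup>l\<^sup>-\<^sup>1\<close>.  By aliasing and integration by parts, its error is the limit of
  \<open>\<Sum> I\<^bsub>k+jN\<^esub>(f\<^sub>s) / \<omega>\<^bsub>k+jN\<^esub>\<^sup>s\<close>, and each of these finite sums obeys the bound.\<close>

lemma err_trapezoid:
  assumes s: "s \<ge> 1" and k: "2 * \<bar>k\<bar> < int (Suc m)"
  shows "err (2 * s + m) k s \<le> ennreal (2 * (3 / (2 * pi * (real (Suc m) + \<bar>real_of_int k\<bar>))) ^ s)"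
proof -
  define N where "N = Suc m"
  have N: "N \<ge> 1" and kN: "2 * \<bar>k\<bar> < int N" using k by (simp_all add: N_def)
  define p where "p j = k + j * int N" for j
  have inj: "inj_on p (punctured M)" for M using N by (auto simp: p_def inj_on_def)
  have p0: "p j \<noteq> 0" if "j \<in> punctured M" for j M
  proof -
    have "0 < \<bar>real_of_int j\<bar>" using that by (simp add: punctured_def)
    then have "cmod (freq (p j)) > 0"
      using norm_alias_freq_ge[OF kN, of j] that unfolding p_def punctured_def by fastforce
    then show ?thesis by simp
  qed
  define b where "b l = lim (\<lambda>M. \<Sum>j\<in>punctured M. 1 / freq (p j) ^ Suc l)" for l
  have b: "(\<lambda>M. \<Sum>j\<in>punctured M. 1 / freq (p j) ^ Suc l) \<longlonglongrightarrow> b l" for l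
    using alias_sum_convergent[OF kN, of l] unfolding b_def p_def convergent_LIMSEQ_iff .
  \<comment> \<open>weights of the derivatives at 0 and at 1; the function values there also carry the trapezoidal weight\<close>
  define \<alpha> where "\<alpha> l = (if l = 0 then 1 / (2 * of_nat N) else 0) - b l" for l
  define \<beta> where "\<beta> l = (if l = 0 then 1 / (2 * of_nat N) else 0) + b l" for l
  define y where "y i = real (Suc i) / real N" for i
  have y: "y i \<in> {0..1}" if "i < m" for i using that by (auto simp: y_def N_def)
  define \<gamma> where "\<gamma> i = wave k (y i) / of_nat N" for i
  show ?thesis
  proof (rule err_le[OF end_point_algorithm[OF s y]])
    fix f assume f: "f \<in> sobolev s" and n: "sob_norm s f \<le> 1"
    define A where "A = (\<Sum>l<s. \<alpha> l * nderiv l f 0) + (\<Sum>l<s. \<beta> l * nderiv l f 1) + (\<Sum>i<m. \<gamma> i * f (y i))"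
    define F where "F x = f x * wave k x" for x
    have FD: "\<exists>D. has_L2_derivative F D"
      using has_L2_derivative_mult[OF sobolev_has_L2_derivative[OF f, of 0] wave_has_L2_derivative[of k]] s
      unfolding F_def by auto
    have A: "A = trapezoid N F + (\<Sum>l<s. jump l f * b l)"
    proof -
      have "(\<Sum>l<s. \<alpha> l * nderiv l f 0) + (\<Sum>l<s. \<beta> l * nderiv l f 1)
          = (\<Sum>l<s. (if l = 0 then (f 0 + f 1) / (2 * of_nat N) else 0) + jump l f * b l)"
        unfolding sum.distrib[symmetric]
        by (intro sum.cong refl) (simp add: \<alpha>_def \<beta>_def jump_def algebra_simps add_divide_distrib)
      also have "\<dots> = (f 0 + f 1) / (2 * of_nat N) + (\<Sum>l<s. jump l f * b l)"
        using s by (simp add: sum.distrib)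
      finally have "A = (f 0 + f 1) / (2 * of_nat N) + (\<Sum>i<m. \<gamma> i * f (y i)) + (\<Sum>l<s. jump l f * b l)"
        by (simp add: A_def)
      moreover have "trapezoid N F = (f 0 + f 1) / (2 * of_nat N) + (\<Sum>i<m. \<gamma> i * f (y i))"
        unfolding N_def trapezoid_nodes by (simp add: F_def \<gamma>_def y_def N_def wave_eq_1 mult.commute)
      ultimately show ?thesis by simp
    qed
    let ?S = "\<lambda>M. \<Sum>j\<in>punctured M. (1 / freq (p j) ^ s) * fourier_int (p j) (nderiv s f)"
    have "?S M = (\<Sum>j\<in>punctured M. fourier_int (j * int N) F) + (\<Sum>l<s. jump l f * (\<Sum>j\<in>punctured M. 1 / freq (p j) ^ Suc l))" for M
    proof -
      have "(\<Sum>j\<in>punctured M. fourier_int (j * int N) F)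
          = (\<Sum>j\<in>punctured M. (1 / freq (p j) ^ s) * fourier_int (p j) (nderiv s f) - (\<Sum>l<s. jump l f * (1 / freq (p j) ^ Suc l)))"
      proof (intro sum.cong refl)
        fix j assume j: "j \<in> punctured M"
        have "fourier_int (j * int N) F = fourier_int (p j) f"
          unfolding F_def fourier_int_shift p_def ..
        also have "\<dots> = fourier_int (p j) (nderiv s f) / freq (p j) ^ s - (\<Sum>l<s. jump l f / freq (p j) ^ Suc l)"
          by (rule fourier_int_parts[OF f order_refl p0[OF j]])
        finally show "fourier_int (j * int N) F = (1 / freq (p j) ^ s) * fourier_int (p j) (nderiv s f) - (\<Sum>l<s. jump l f * (1 / freq (p j) ^ Suc l))"
          by simp
      qed
      also have "\<dots> = ?S M - (\<Sum>l<s. jump l f * (\<Sum>j\<in>punctured M. 1 / freq (p j) ^ Suc l))"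
        unfolding sum_subtractf sum_distrib_left by (subst sum.swap) (rule refl)
      finally show ?thesis by simp
    qed
    moreover have "(\<lambda>M. (\<Sum>j\<in>punctured M. fourier_int (j * int N) F) + (\<Sum>l<s. jump l f * (\<Sum>j\<in>punctured M. 1 / freq (p j) ^ Suc l)))
        \<longlonglongrightarrow> (trapezoid N F - (LINT x|lebesgue_on {0..1}. F x)) + (\<Sum>l<s. jump l f * b l)"
      using FD trapezoid_aliasing[OF N, of F] by (intro tendsto_intros b) auto
    moreover have "(LINT x|lebesgue_on {0..1}. F x) = fourier_int k f"
      unfolding F_def fourier_int_eq ..
    ultimately have "?S \<longlonglongrightarrow> A - fourier_int k f"
      by (simp add: A algebra_simps)
    then have "(\<lambda>M. cmod (?S M)) \<longlonglongrightarrow> cmod (A - fourier_int k f)" by (rule tendsto_norm)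
    moreover have "cmod (?S M) \<le> 2 * (3 / (2 * pi * (real N + \<bar>real_of_int k\<bar>))) ^ s" for M
    proof -
      have "cmod (?S M) \<le> sqrt (\<Sum>j\<in>punctured M. (cmod (1 / freq (p j) ^ s))\<^sup>2) * L2norm (nderiv s f)"
        by (rule fourier_sum_bound[OF finite_punctured inj sobolev_sq_integrable[OF f]])
      also have "\<dots> \<le> sqrt (\<Sum>j\<in>punctured M. (cmod (1 / freq (p j) ^ s))\<^sup>2) * 1"
        using L2norm_le_sob_norm[of s f] n by (intro mult_left_mono) (auto simp: sum_nonneg)
      also have "\<dots> \<le> 2 * (3 / (2 * pi * (real N + \<bar>real_of_int k\<bar>))) ^ s"
        using alias_sum_sq_bound[OF kN s, of M] unfolding p_def by simp
      finally show ?thesis .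
    qed
    ultimately have "cmod (A - fourier_int k f) \<le> 2 * (3 / (2 * pi * (real N + \<bar>real_of_int k\<bar>))) ^ s"
      by (intro LIMSEQ_le_const2) auto
    then show "cmod (fourier_int k f - ((\<Sum>l<s. \<alpha> l * nderiv l f 0) + (\<Sum>l<s. \<beta> l * nderiv l f 1) + (\<Sum>i<m. \<gamma> i * f (y i))))
        \<le> 2 * (3 / (2 * pi * (real (Suc m) + \<bar>real_of_int k\<bar>))) ^ s"
      unfolding A_def[symmetric] N_def[symmetric] by (subst norm_minus_commute)
  qed
qed

text \<open>The two algorithms meet at \<open>m + 1 = 2|k|\<close>: up to there \<open>m + 1 + |k| \<le> 3|k|\<close>, so the fixed error
  \<open>(2\<pi>|k|)\<^sup>-\<^sup>s\<close> of the end point algorithm is small enough.\<close>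

theorem err_upper:
  assumes s: "s \<ge> 1"
  shows "err (2 * s + m) k s \<le> ennreal (2 * (3 / (2 * pi * (real m + 1 + \<bar>real_of_int k\<bar>))) ^ s)"
proof (cases "2 * \<bar>k\<bar> < int (Suc m)")
  case True
  from err_trapezoid[OF s this] show ?thesis by (simp add: add_ac)
next
  case False
  then have k: "k \<noteq> 0" by auto
  have "int (Suc m) \<le> 2 * \<bar>k\<bar>" using False by simp
  then have "real_of_int (int (Suc m)) \<le> real_of_int (2 * \<bar>k\<bar>)" by (rule of_int_le_iff[THEN iffD2])
  then have m: "real m + 1 + \<bar>real_of_int k\<bar> \<le> 3 * \<bar>real_of_int k\<bar>" by simp
  have "1 / (2 * pi * \<bar>real_of_int k\<bar>) = 3 / (2 * pi * (3 * \<bar>real_of_int k\<bar>))" by simp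
  also have "\<dots> \<le> 3 / (2 * pi * (real m + 1 + \<bar>real_of_int k\<bar>))"
    using k m by (intro divide_left_mono mult_left_mono mult_pos_pos) auto
  finally have "(1 / (2 * pi * \<bar>real_of_int k\<bar>)) ^ s \<le> (3 / (2 * pi * (real m + 1 + \<bar>real_of_int k\<bar>))) ^ s"
    by (intro power_mono) auto
  also have "\<dots> \<le> 2 * (3 / (2 * pi * (real m + 1 + \<bar>real_of_int k\<bar>))) ^ s" by simp
  finally show ?thesis
    using err_end_points[OF s k, of m] by (meson ennreal_leI order_trans)
qed

section \<open>The initial error\<close>

lemma err_zero: "err 0 k s = (SUP f\<in>{f \<in> sobolev s. sob_norm s f \<le> 1}. ennreal (cmod (fourier_int k f)))"
proof -
  have "algorithms 0 s = {\<lambda>_. 0}" by (auto simp: algorithms_def)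
  then show ?thesis by (simp add: err_def min_error_def)
qed

lemma centred_identity_derivatives:
  assumes "x \<in> {0..1}"
  shows "nderiv (Suc l) (\<lambda>x. complex_of_real (x - 1/2)) x = (if l = 0 then 1 else 0)"
  using assms
proof (induction l arbitrary: x)
  case 0
  have "((\<lambda>x. complex_of_real (x - 1/2)) has_vector_derivative of_real 1) (at x within {0..1})"
    by (intro has_vector_derivative_of_real) (auto intro!: derivative_eq_intros)
  then have "vector_derivative (\<lambda>x. complex_of_real (x - 1/2)) (at x within {0..1}) = 1"
    using vector_derivative_within_closed_interval[of 0 1 x] 0 by simp
  then show ?case by (simp add: nderiv_Suc)
next
  case (Suc l)
  have "(nderiv (Suc l) (\<lambda>x. complex_of_real (x - 1/2)) has_vector_derivative 0) (at x within {0..1})"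
    by (rule has_vector_derivative_transform[OF Suc.prems Suc.IH has_vector_derivative_const])
  then have "vector_derivative (nderiv (Suc l) (\<lambda>x. complex_of_real (x - 1/2))) (at x within {0..1}) = 0"
    using vector_derivative_within_closed_interval[of 0 1 x] Suc.prems by simp
  then show ?case by (simp add: nderiv_Suc[of "Suc l"])
qed

lemma LINT_unit_cong:
  fixes f g :: "real \<Rightarrow> 'a::{banach, second_countable_topology}"
  assumes "\<And>x. x \<in> {0..1} \<Longrightarrow> f x = g x"
  shows "(LINT x|lebesgue_on {0..1}. f x) = (LINT x|lebesgue_on {0..1}. g x)"
  using assms by (intro Bochner_Integration.integral_cong) auto

text \<open>The function \<open>x - 1/2\<close> has mean 0, first derivative 1 and higher derivatives 0.  So its norm is 1 for every
  \<open>s \<ge> 1\<close>; the contribution of the derivative comes from the last term of the norm if \<open>s = 1\<close>, and from the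
  mean with index 1 otherwise.\<close>

lemma err_zero_ge:
  assumes s: "s \<ge> 1" and k: "k \<noteq> 0"
  shows "ennreal (1 / (2 * pi * \<bar>real_of_int k\<bar>)) \<le> err 0 k s"
proof -
  define f where "f = (\<lambda>x. complex_of_real (x - 1/2))"
  have nd: "nderiv (Suc l) f x = (if l = 0 then 1 else 0)" if "x \<in> {0..1}" for l x
    using centred_identity_derivatives[OF that] by (simp add: f_def)
  have vd: "(f has_vector_derivative 1) (at x within {0..1})" for x
    using has_vector_derivative_of_real[of "\<lambda>x. x - 1/2" 1 "at x within {0..1}", where 'a = complex]
    unfolding f_def by (auto intro!: derivative_eq_intros)
  have vds: "(nderiv l f has_vector_derivative nderiv (Suc l) f x) (at x within {0..1})" if "x \<in> {0..1}" for l x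
  proof (cases l)
    case 0
    then show ?thesis using vd nd[OF that, of 0] by simp
  next
    case (Suc i)
    have "(nderiv (Suc i) f has_vector_derivative 0) (at x within {0..1})"
      by (rule has_vector_derivative_transform[OF that nd has_vector_derivative_const])
    then show ?thesis using nd[OF that, of "Suc i"] Suc by simp
  qed
  have cont: "continuous_on {0..1} (nderiv (Suc l) f)" for l
    by (subst continuous_on_cong[OF refl nd]) auto
  have L2: "has_L2_derivative (nderiv l f) (nderiv (Suc l) f)" for l
    by (rule has_L2_derivative_C1[OF vds cont])
  obtain t where t: "s = Suc t" using s by (cases s) auto
  have "f \<in> sobolev s"
    using L2[of t] differentiableI_vector[OF vds] unfolding sobolev_def t
    by (auto simp: has_L2_derivative_def sq_integrable_def elim: eventually_mono intro: differentiableI_vector)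
  moreover have "sob_norm s f = 1"
  proof -
    have "((\<lambda>x. complex_of_real (x\<^sup>2 / 2 - x / 2)) has_vector_derivative f x) (at x within {0..1})" for x
      unfolding f_def by (intro has_vector_derivative_of_real) (auto intro!: derivative_eq_intros)
    then have "has_L2_derivative (\<lambda>x. complex_of_real (x\<^sup>2 / 2 - x / 2)) f"
      by (intro has_L2_derivative_C1) (auto simp: f_def intro!: continuous_intros)
    then have f0: "(LINT x|lebesgue_on {0..1}. f x) = 0"
      using has_L2_derivative_LINT by fastforce
    have "(LINT x|lebesgue_on {0..1}. nderiv (Suc l) f x) = (if l = 0 then 1 else 0)" for l
      using LINT_unit_cong[OF nd[of _ l]] by simp
    then have "(\<Sum>l<s. (cmod (LINT x|lebesgue_on {0..1}. nderiv l f x))\<^sup>2)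
        = (\<Sum>l<t. (cmod (if l = 0 then 1 else 0))\<^sup>2)"
      unfolding t sum.lessThan_Suc_shift by (simp add: f0)
    also have "\<dots> = (\<Sum>l<t. if l = 0 then 1 else 0)"
      by (intro sum.cong) auto
    also have "\<dots> = (if t = 0 then 0 else 1)" by simp
    finally have 1: "(\<Sum>l<s. (cmod (LINT x|lebesgue_on {0..1}. nderiv l f x))\<^sup>2) = (if t = 0 then 0 else 1)" .
    have "(LINT x|lebesgue_on {0..1}. (cmod (nderiv (Suc t) f x))\<^sup>2) = (LINT x|lebesgue_on {0..1::real}. (if t = 0 then 1 else 0))"
      by (rule LINT_unit_cong) (simp add: nd)
    then have "(L2norm (nderiv s f))\<^sup>2 = (if t = 0 then 1 else 0)"
      by (simp add: L2norm_def t)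
    with 1 show ?thesis unfolding sob_norm_eq by simp
  qed
  moreover have "cmod (fourier_int k f) = 1 / (2 * pi * \<bar>real_of_int k\<bar>)"
  proof -
    have "fourier_int k (\<lambda>_. 1) = f 1 - f 0 + freq k * fourier_int k f"
      by (rule fourier_int_derivative[OF has_L2_derivative_C1[OF vd]]) simp
    then have "freq k * fourier_int k f = - 1"
      using k by (simp add: fourier_int_eq LINT_wave f_def add_eq_0_iff)
    then have "cmod (freq k) * cmod (fourier_int k f) = 1"
      by (metis norm_minus_cancel norm_mult norm_one)
    then show ?thesis using k by (simp add: norm_freq field_simps)
  qed
  ultimately show ?thesis
    unfolding err_zero by (intro SUP_upper2[of f]) auto
qed

text \<open>The squared norm of \<open>I\<^sub>k\<close> on the Sobolev space is the left-hand side, for \<open>\<rho> = 1 / (2\<pi>k)\<^sup>2\<close> and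
  \<open>s = t + 1\<close>.\<close>

lemma sum_geometric_le:
  fixes \<rho> :: real
  assumes "0 \<le> \<rho>" "\<rho> \<le> 1/2"
  shows "(\<Sum>l<t. \<rho> ^ Suc l) + 2 * \<rho> ^ Suc t \<le> 2 * \<rho>"
proof (induction t)
  case (Suc t)
  have "\<rho> ^ Suc t * (2 * \<rho>) \<le> \<rho> ^ Suc t * 1" using assms by (intro mult_left_mono) auto
  then show ?case using Suc by (simp add: mult_ac)
qed simp

text \<open>All but the last integration by parts produce \<open>jump l f\<close>, the mean of the derivative of order
  \<open>l + 1\<close>.  In the last one, the boundary term is joined with the integral to
  \<open>I\<^sub>k(f\<^sub>s) - I\<^sub>0(f\<^sub>s)\<close>, whose norm as a functional of \<open>f\<^sub>s\<close> is \<open>\<surd>2\<close>.  The Cauchy--Schwarz inequality for the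
  resulting sum of \<open>s\<close> terms gives the bound.\<close>

lemma err_zero_le:
  assumes s: "s \<ge> 1" and k: "k \<noteq> 0"
  shows "err 0 k s \<le> ennreal (1 / (sqrt 2 * pi * \<bar>real_of_int k\<bar>))"
  unfolding err_zero
proof (rule SUP_least, rule ennreal_leI)
  fix f assume "f \<in> {f \<in> sobolev s. sob_norm s f \<le> 1}"
  then have f: "f \<in> sobolev s" and n: "sob_norm s f \<le> 1" by auto
  obtain t where t: "s = Suc t" using s by (cases s) auto
  define r where "r = 1 / (2 * pi * \<bar>real_of_int k\<bar>)"
  have k1: "\<bar>real_of_int k\<bar> \<ge> 1" using k by simp
  have r: "0 < r" "r \<le> 1/2"
    using k1 pi_gt3 mult_mono[of 1 pi 1 "\<bar>real_of_int k\<bar>"] by (auto simp: r_def field_simps)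
  have nfreq: "cmod (1 / freq k) = r" by (simp add: norm_divide norm_freq r_def)
  \<comment> \<open>the components of \<open>f\<close> that the norm controls, and their coefficients in the Fourier integral\<close>
  define b where "b l = (if l < t then cmod (LINT x|lebesgue_on {0..1}. nderiv (Suc l) f x) else L2norm (nderiv s f))" for l
  define a where "a l = (if l < t then r ^ Suc l else sqrt 2 * r ^ Suc l)" for l
  have mean: "(LINT x|lebesgue_on {0..1}. nderiv (Suc l) f x) = jump l f" if "l < s" for l
    using has_L2_derivative_LINT[OF sobolev_has_L2_derivative[OF f that]] by (simp add: jump_def)
  have top: "cmod (fourier_int k (nderiv t f)) \<le> r * (sqrt 2 * L2norm (nderiv s f))"
  proof -
    have sq: "sq_integrable (nderiv s f)" by (rule sobolev_sq_integrable[OF f])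
    have "freq k * fourier_int k (nderiv t f) = fourier_int k (nderiv s f) - jump t f"
      using fourier_int_derivative[OF sobolev_has_L2_derivative[OF f, of t], of k] by (simp add: t jump_def)
    also have "jump t f = fourier_int 0 (nderiv s f)"
      using mean[of t] by (simp add: t fourier_int_eq)
    also have "fourier_int k (nderiv s f) - fourier_int 0 (nderiv s f)
       = (\<Sum>j\<in>{k, 0}. (if j = k then 1 else - 1) * fourier_int j (nderiv s f))"
      using k by simp
    finally have "cmod (freq k * fourier_int k (nderiv t f)) \<le>
        sqrt (\<Sum>j\<in>{k, 0}. (cmod (if j = k then 1 else - 1))\<^sup>2) * L2norm (nderiv s f)"
      using fourier_sum_bound[of "{k, 0}" "\<lambda>j. j", OF _ _ sq, of "\<lambda>j. if j = k then 1 else - 1"] by simp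
    also have "(\<Sum>j\<in>{k, 0}. (cmod (if j = k then 1 else - 1))\<^sup>2) = 2" using k by simp
    finally have "r * cmod (freq k * fourier_int k (nderiv t f)) \<le> r * (sqrt 2 * L2norm (nderiv s f))"
      using r by (intro mult_left_mono) auto
    moreover have "r * cmod (freq k * fourier_int k (nderiv t f)) = cmod (fourier_int k (nderiv t f))"
      unfolding norm_mult mult.assoc[symmetric] using k by (simp add: r_def norm_freq)
    ultimately show ?thesis by simp
  qed
  have "cmod (fourier_int k f) = cmod (fourier_int k (nderiv t f) * (1 / freq k) ^ t - (\<Sum>l<t. jump l f * (1 / freq k) ^ Suc l))"
    using fourier_int_parts[OF f, of t k] k t by (simp add: power_divide)
  also have "\<dots> \<le> cmod (fourier_int k (nderiv t f) * (1 / freq k) ^ t) + (\<Sum>l<t. cmod (jump l f * (1 / freq k) ^ Suc l))"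
    by (rule order_trans[OF norm_triangle_ineq4]) (intro add_left_mono norm_sum)
  also have "\<dots> = cmod (fourier_int k (nderiv t f)) * r ^ t + (\<Sum>l<t. cmod (jump l f) * r ^ Suc l)"
    unfolding norm_mult norm_power nfreq ..
  also have "\<dots> \<le> (r * (sqrt 2 * L2norm (nderiv s f))) * r ^ t + (\<Sum>l<t. cmod (jump l f) * r ^ Suc l)"
    using r by (intro add_right_mono mult_right_mono top) auto
  also have "\<dots> = (\<Sum>l<Suc t. a l * b l)"
    using mean by (simp add: a_def b_def t mult_ac)
  also have "\<dots> \<le> sqrt (\<Sum>l<Suc t. (a l)\<^sup>2) * sqrt (\<Sum>l<Suc t. (b l)\<^sup>2)"
  proof -
    have "(\<Sum>l<Suc t. a l * b l)\<^sup>2 \<le> (\<Sum>l<Suc t. (a l)\<^sup>2) * (\<Sum>l<Suc t. (b l)\<^sup>2)"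
      by (rule Cauchy_Schwarz_ineq_sum)
    then show ?thesis unfolding real_sqrt_mult[symmetric] by (rule real_le_rsqrt)
  qed
  also have "\<dots> \<le> sqrt (2 * r\<^sup>2) * 1"
  proof (intro mult_mono)
    have r2: "r\<^sup>2 \<le> 1/2" using mult_mono[OF r(2) r(2)] r by (simp add: power2_eq_square)
    have "(\<Sum>l<Suc t. (a l)\<^sup>2) = (\<Sum>l<t. (r\<^sup>2) ^ Suc l) + 2 * (r\<^sup>2) ^ Suc t"
      by (simp add: a_def power_mult_distrib power_mult[symmetric] mult.commute[of 2] del: power_Suc)
    also have "\<dots> \<le> 2 * r\<^sup>2" by (rule sum_geometric_le) (use r2 in auto)
    finally show "sqrt (\<Sum>l<Suc t. (a l)\<^sup>2) \<le> sqrt (2 * r\<^sup>2)" by simp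
    have "(\<Sum>l<Suc t. (b l)\<^sup>2) = (\<Sum>l<t. (cmod (LINT x|lebesgue_on {0..1}. nderiv (Suc l) f x))\<^sup>2) + (L2norm (nderiv s f))\<^sup>2"
      by (simp add: b_def)
    also have "\<dots> \<le> (\<Sum>l<s. (cmod (LINT x|lebesgue_on {0..1}. nderiv l f x))\<^sup>2) + (L2norm (nderiv s f))\<^sup>2"
      unfolding t sum.lessThan_Suc_shift by simp
    finally show "sqrt (\<Sum>l<Suc t. (b l)\<^sup>2) \<le> 1"
      using n unfolding sob_norm_eq by (meson order_trans real_sqrt_le_mono)
  qed (auto simp: sum_nonneg)
  also have "\<dots> = sqrt 2 * r" using r by (simp add: real_sqrt_mult)
  also have "\<dots> = 1 / (sqrt 2 * pi * \<bar>real_of_int k\<bar>)"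
  proof -
    have "sqrt 2 * sqrt 2 = (2::real)" by simp
    then show ?thesis using k by (simp add: r_def divide_simps)
  qed
  finally show "cmod (fourier_int k f) \<le> 1 / (sqrt 2 * pi * \<bar>real_of_int k\<bar>)" .
qed

section \<open>Information complexity\<close>

lemma err_per_le_err: "err_per n k s \<le> err n k s"
  unfolding err_per_def err_def min_error_def
  by (intro INF_mono' SUP_subset_mono) (auto simp: sobolev_per_def)

lemma power_powr_root:
  fixes x :: real
  assumes "s \<ge> 1" "x > 0"
  shows "(x ^ s) powr (1 / real s) = x" "(x powr (1 / real s)) ^ s = x"
  using assms by (simp_all add: powr_realpow[symmetric] powr_powr)

text \<open>The hypothesis on \<open>m\<close> guarantees that the error bound with \<open>2s + m\<close> values is at most
  \<open>\<epsilon> / (2\<pi>|k|)\<close>, and \<open>1 / (2\<pi>|k|)\<close> is a lower bound for the initial error.\<close>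

lemma err_normalized_upper:
  fixes \<epsilon> :: real
  assumes s: "s \<ge> 1" and k: "k \<noteq> 0" and \<epsilon>: "\<epsilon> > 0"
    and m: "3 / (2 * pi) * (4 * pi * \<bar>real_of_int k\<bar> / \<epsilon>) powr (1 / real s) \<le> real m + 1 + \<bar>real_of_int k\<bar>"
  shows "err (2 * s + m) k s \<le> ennreal \<epsilon> * err 0 k s"
proof -
  define K where "K = \<bar>real_of_int k\<bar>"
  have K: "K > 0" using k by (simp add: K_def)
  define Y where "Y = (4 * pi * K / \<epsilon>) powr (1 / real s)"
  have Y: "Y > 0" "Y ^ s = 4 * pi * K / \<epsilon>"
    using K \<epsilon> power_powr_root(2)[OF s, of "4 * pi * K / \<epsilon>"] by (simp_all add: Y_def)
  have mY: "3 / (2 * pi) * Y \<le> real m + 1 + K" using m by (simp add: Y_def K_def)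
  have "3 / (2 * pi * (real m + 1 + K)) \<le> 1 / Y"
    using mY Y K by (simp add: field_simps add_pos_nonneg)
  then have "(3 / (2 * pi * (real m + 1 + K))) ^ s \<le> (1 / Y) ^ s"
    using K by (intro power_mono) auto
  also have "\<dots> = \<epsilon> / (4 * pi * K)" unfolding power_divide Y by simp
  finally have "2 * (3 / (2 * pi * (real m + 1 + K))) ^ s \<le> \<epsilon> * (1 / (2 * pi * K))"
    by simp
  then have "err (2 * s + m) k s \<le> ennreal (\<epsilon> * (1 / (2 * pi * K)))"
    using err_upper[OF s, of m k] unfolding K_def[symmetric] by (meson ennreal_leI order_trans)
  also have "\<dots> = ennreal \<epsilon> * ennreal (1 / (2 * pi * K))"
    using \<epsilon> K by (intro ennreal_mult) auto
  also have "\<dots> \<le> ennreal \<epsilon> * err 0 k s"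
    using err_zero_ge[OF s k] by (intro mult_left_mono) (auto simp: K_def)
  finally show ?thesis .
qed

text \<open>The initial error is positive and finite, so a factor \<open>\<epsilon> < 1\<close> strictly decreases it.\<close>

lemma err_normalized_nonzero:
  fixes \<epsilon> :: real
  assumes s: "s \<ge> 1" and k: "k \<noteq> 0" and \<epsilon>: "0 < \<epsilon>" "\<epsilon> < 1"
    and le: "err n k s \<le> ennreal \<epsilon> * err 0 k s"
  shows "n \<ge> 1"
proof (rule ccontr)
  assume "\<not> n \<ge> 1"
  then have n: "n = 0" by simp
  have "err 0 k s \<noteq> top" using err_zero_le[OF s k] by (auto simp: top_unique)
  then obtain e where e: "err 0 k s = ennreal e" "e \<ge> 0" by (cases "err 0 k s") auto
  have "0 < 1 / (2 * pi * \<bar>real_of_int k\<bar>)" using k by simp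
  also have "\<dots> \<le> e" using err_zero_ge[OF s k] e by (simp add: ennreal_le_iff)
  finally have "e > 0" .
  have "ennreal e \<le> ennreal (\<epsilon> * e)" using le \<epsilon> e unfolding n by (simp add: ennreal_mult)
  then have "e \<le> \<epsilon> * e" using \<epsilon> e by (subst (asm) ennreal_le_iff) auto
  with \<open>e > 0\<close> \<epsilon> show False by simp
qed

lemma err_normalized_lower:
  fixes \<epsilon> c :: real
  assumes s: "s \<ge> 1" and k: "k \<noteq> 0" and \<epsilon>: "0 < \<epsilon>" "\<epsilon> < 1" and c: "c > 0"
    and per: "\<And>n. n \<ge> 1 \<Longrightarrow> ennreal (c / (real n + \<bar>real_of_int k\<bar>) ^ s) \<le> err_per n k s"
    and le: "err n k s \<le> ennreal \<epsilon> * err 0 k s"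
  shows "c powr (1 / real s) * (sqrt 2 * pi * \<bar>real_of_int k\<bar> / \<epsilon>) powr (1 / real s) - \<bar>real_of_int k\<bar> \<le> real n"
proof -
  define K where "K = \<bar>real_of_int k\<bar>"
  have K: "K > 0" using k by (simp add: K_def)
  have nK: "real n + K > 0" using K by simp
  define Y where "Y = sqrt 2 * pi * K / \<epsilon>"
  have Y: "Y > 0" using K \<epsilon> by (simp add: Y_def)
  have "ennreal (c / (real n + K) ^ s) \<le> err n k s"
    using per[OF err_normalized_nonzero[OF s k \<epsilon> le]] err_per_le_err[of n k s] by (simp add: K_def)
  also note le
  also have "ennreal \<epsilon> * err 0 k s \<le> ennreal \<epsilon> * ennreal (1 / (sqrt 2 * pi * K))"
    using err_zero_le[OF s k] by (intro mult_left_mono) (auto simp: K_def)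
  also have "\<dots> = ennreal (\<epsilon> * (1 / (sqrt 2 * pi * K)))"
    using \<epsilon> K by (intro ennreal_mult[symmetric]) auto
  also have "\<epsilon> * (1 / (sqrt 2 * pi * K)) = 1 / Y" by (simp add: Y_def)
  finally have "c / (real n + K) ^ s \<le> 1 / Y" using Y by (subst (asm) ennreal_le_iff) auto
  then have "c * Y \<le> (real n + K) ^ s" using nK Y by (simp add: divide_simps)
  then have "(c * Y) powr (1 / real s) \<le> ((real n + K) ^ s) powr (1 / real s)"
    using c Y by (intro powr_mono2) auto
  also have "\<dots> = real n + K" by (rule power_powr_root(1)[OF s nK])
  finally have "c powr (1 / real s) * Y powr (1 / real s) \<le> real n + K"
    using c Y by (simp add: powr_mult)
  then show ?thesis by (simp add: Y_def K_def)
qed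

theorem corollary17:
  fixes s :: nat and c :: real
  assumes "s \<ge> 1"
    and "c > 0"
    and "\<And>(k::int) (n::nat). n \<ge> 1 \<Longrightarrow>
           ennreal (c / (real n + \<bar>real_of_int k\<bar>) ^ s) \<le> err_per n k s"
  shows "(\<forall>k::int. \<forall>\<epsilon>::real. k \<noteq> 0 \<and> 0 < \<epsilon> \<and> \<epsilon> < 1 \<longrightarrow>
            (\<exists>n. err n k s \<le> ennreal \<epsilon> * err 0 k s) \<and>
            c powr (1 / real s) * (sqrt 2 * pi * \<bar>real_of_int k\<bar> / \<epsilon>) powr (1 / real s)
                - \<bar>real_of_int k\<bar> \<le> real (n_nor \<epsilon> k s) \<and>
            int (n_nor \<epsilon> k s) \<le> 2 * int s +
                max 0 (\<lceil>3 / (2 * pi) * (4 * pi * \<bar>real_of_int k\<bar> / \<epsilon>) powr (1 / real s)\<rceil> - 1 - \<bar>k\<bar>))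
       \<and> (\<exists>C1>0. \<exists>C2>0. \<forall>k::int. k \<noteq> 0 \<longrightarrow>
            (\<forall>\<^sub>F \<epsilon> in at_right (0::real).
               C1 * (\<bar>real_of_int k\<bar> powr (1 / real s) / \<epsilon> powr (1 / real s)) \<le> real (n_nor \<epsilon> k s) \<and>
               real (n_nor \<epsilon> k s) \<le> C2 * (\<bar>real_of_int k\<bar> powr (1 / real s) / \<epsilon> powr (1 / real s))))"
proof -
  note s = assms(1) and c = assms(2) and per = assms(3)
  have main: "(\<exists>n. err n k s \<le> ennreal \<epsilon> * err 0 k s) \<and>
      c powr (1 / real s) * (sqrt 2 * pi * \<bar>real_of_int k\<bar> / \<epsilon>) powr (1 / real s)
        - \<bar>real_of_int k\<bar> \<le> real (n_nor \<epsilon> k s) \<and>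
      int (n_nor \<epsilon> k s) \<le> 2 * int s +
        max 0 (\<lceil>3 / (2 * pi) * (4 * pi * \<bar>real_of_int k\<bar> / \<epsilon>) powr (1 / real s)\<rceil> - 1 - \<bar>k\<bar>)"
    if k: "k \<noteq> 0" and \<epsilon>: "0 < \<epsilon>" "\<epsilon> < 1" for k :: int and \<epsilon> :: real
  proof -
    define X where "X = 3 / (2 * pi) * (4 * pi * \<bar>real_of_int k\<bar> / \<epsilon>) powr (1 / real s)"
    define m where "m = nat (max 0 (\<lceil>X\<rceil> - 1 - \<bar>k\<bar>))"
    have im: "int m = max 0 (\<lceil>X\<rceil> - 1 - \<bar>k\<bar>)" by (simp add: m_def)
    then have "\<lceil>X\<rceil> \<le> int m + 1 + \<bar>k\<bar>" by linarith
    then have "X \<le> real_of_int (int m + 1 + \<bar>k\<bar>)" by (simp only: ceiling_le_iff)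
    then have "X \<le> real m + 1 + \<bar>real_of_int k\<bar>" by simp
    then have up: "err (2 * s + m) k s \<le> ennreal \<epsilon> * err 0 k s"
      unfolding X_def by (rule err_normalized_upper[OF s k \<epsilon>(1)])
    then have "err (n_nor \<epsilon> k s) k s \<le> ennreal \<epsilon> * err 0 k s"
      unfolding n_nor_def by (rule LeastI)
    from err_normalized_lower[OF s k \<epsilon> c per this]
    have low: "c powr (1 / real s) * (sqrt 2 * pi * \<bar>real_of_int k\<bar> / \<epsilon>) powr (1 / real s) - \<bar>real_of_int k\<bar>
        \<le> real (n_nor \<epsilon> k s)" by blast
    have "n_nor \<epsilon> k s \<le> 2 * s + m"
      using up unfolding n_nor_def by (rule Least_le)
    then have "int (n_nor \<epsilon> k s) \<le> 2 * int s + max 0 (\<lceil>X\<rceil> - 1 - \<bar>k\<bar>)"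
      using im by linarith
    with up low show ?thesis unfolding X_def by blast
  qed
  define \<sigma> where "\<sigma> = 1 / real s"
  \<comment> \<open>\<open>C1\<close> is half the constant of the lower bound; \<open>C2\<close> absorbs the summand \<open>2 s\<close> because \<open>|k| / \<epsilon> \<ge> 1\<close>\<close>
  define C1 where "C1 = c powr \<sigma> * (sqrt 2 * pi) powr \<sigma> / 2"
  define C2 where "C2 = 2 * real s + 3 / (2 * pi) * (4 * pi) powr \<sigma>"
  have C: "C1 > 0" "C2 > 0" using c s by (auto simp: C1_def C2_def intro!: add_pos_pos)
  have asymp: "\<forall>\<^sub>F \<epsilon> in at_right (0::real).
      C1 * (\<bar>real_of_int k\<bar> powr \<sigma> / \<epsilon> powr \<sigma>) \<le> real (n_nor \<epsilon> k s) \<and>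
      real (n_nor \<epsilon> k s) \<le> C2 * (\<bar>real_of_int k\<bar> powr \<sigma> / \<epsilon> powr \<sigma>)" if k: "k \<noteq> 0" for k :: int
  proof -
    define K where "K = \<bar>real_of_int k\<bar>"
    have K: "K \<ge> 1" using k by (simp add: K_def)
    \<comment> \<open>below \<open>d\<close>, the term \<open>- |k|\<close> in the lower bound costs at most half of the main term\<close>
    define d where "d = (C1 * K powr \<sigma> / K) ^ s"
    have d: "d > 0" using C K by (simp add: d_def)
    have "\<forall>\<^sub>F \<epsilon> in at_right (0::real). \<epsilon> \<in> {0<..<min 1 d}"
      by (rule eventually_at_right_real) (use d in auto)
    then show ?thesis
    proof (eventually_elim, intro conjI)
      fix \<epsilon> :: real assume "\<epsilon> \<in> {0<..<min 1 d}"
      then have \<epsilon>: "0 < \<epsilon>" "\<epsilon> < 1" "\<epsilon> \<le> d" by auto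
      define T where "T = K powr \<sigma> / \<epsilon> powr \<sigma>"
      have T: "T > 0" using K \<epsilon> by (simp add: T_def)
      have scale: "(a * K / \<epsilon>) powr \<sigma> = a powr \<sigma> * T" if "a \<ge> 0" for a
        using that K \<epsilon> by (simp add: T_def powr_mult powr_divide)
      have T1: "T \<ge> 1"
      proof -
        have "1 \<le> (K / \<epsilon>) powr \<sigma>" using K \<epsilon> by (intro ge_one_powr_ge_zero) (auto simp: \<sigma>_def)
        then show ?thesis using K \<epsilon> by (simp add: T_def powr_divide)
      qed
      have "\<epsilon> powr \<sigma> \<le> d powr \<sigma>" using \<epsilon> by (intro powr_mono2) (auto simp: \<sigma>_def)
      also have "\<dots> = C1 * K powr \<sigma> / K"
        unfolding d_def \<sigma>_def by (rule power_powr_root(1)[OF s]) (use C K in auto)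
      finally have KT: "K \<le> C1 * T" using K \<epsilon> by (simp add: T_def field_simps)
      have "c powr \<sigma> * (sqrt 2 * pi * K / \<epsilon>) powr \<sigma> = 2 * C1 * T"
        using scale[of "sqrt 2 * pi"] by (simp add: C1_def)
      then have "2 * C1 * T - K \<le> real (n_nor \<epsilon> k s)"
        using main[OF k \<epsilon>(1,2)] unfolding \<sigma>_def K_def by simp
      with KT show "C1 * (\<bar>real_of_int k\<bar> powr \<sigma> / \<epsilon> powr \<sigma>) \<le> real (n_nor \<epsilon> k s)"
        unfolding T_def K_def by simp
      define X where "X = 3 / (2 * pi) * (4 * pi * K / \<epsilon>) powr \<sigma>"
      have X: "X = 3 / (2 * pi) * (4 * pi) powr \<sigma> * T"
        using scale[of "4 * pi"] by (simp add: X_def)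
      have "X > 0" using X T by simp
      have "int (n_nor \<epsilon> k s) \<le> 2 * int s + max 0 (\<lceil>X\<rceil> - 1 - \<bar>k\<bar>)"
        using main[OF k \<epsilon>(1,2)] unfolding X_def \<sigma>_def K_def by blast
      then have "real_of_int (int (n_nor \<epsilon> k s)) \<le> real_of_int (2 * int s + max 0 (\<lceil>X\<rceil> - 1 - \<bar>k\<bar>))"
        by (rule of_int_le_iff[THEN iffD2])
      also have "\<dots> \<le> 2 * real s + X"
        using \<open>X > 0\<close> by (simp add: max_def) linarith
      also have "\<dots> \<le> 2 * real s * T + X" using T1 s by simp
      also have "\<dots> = C2 * T" by (simp add: X C2_def algebra_simps)
      finally show "real (n_nor \<epsilon> k s) \<le> C2 * (\<bar>real_of_int k\<bar> powr \<sigma> / \<epsilon> powr \<sigma>)"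
        by (simp add: T_def K_def)
    qed
  qed
  show ?thesis
    using main asymp C unfolding \<sigma>_def by blast
qed

end
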